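(* Suppose $\tau\in X$. Then one of the following five possibilities holds: (1) $\tau=2\omega_i^\vee$ with $i\in J$; (2) $\tau=\omega_i^\vee$ with $m_i=2$; (3) $\tau=\omega_i^\vee+\omega_j^\vee$ with $i,j\in J$, $i\neq j$; (4) $\tau=\omega_i^\vee$ with $i\in J$; (5) $\tau=0$. Moreover $\Delta_\tau^2\ne\emptyset$, whence $\mathfrak i_{(\tau)}\ne0$, exactly in cases (1), (2), (3). In case (1) the special abelian ideal $\mathfrak i_{(\tau)}$ is nilradical, and conversely (if $\mathfrak i_{(\tau)}\neq 0$ is nilradical then $\tau$ is as in (1)). In cases (2) and (3) $\mathfrak i_{(\tau)}$ is not nilradical, and the relations $\mathfrak i_{(\tau)}\subsetneq\mathfrak n_\tau$ and $\mathfrak i_{(\tau)}=[\mathfrak n_\tau,\mathfrak n_\tau]$ hold.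
   Context: $\mathfrak g$ is a finite-dimensional complex simple Lie algebra, $\mathfrak b=\mathfrak h\oplus\mathfrak n$ a Borel subalgebra, $\Delta$, $\Delta^+$, $\Pi=\{\alpha_1,\dots,\alpha_n\}$ the roots, positive roots, simple roots, $\theta=\sum_im_i\alpha_i$ the highest root, $J=\{i\mid m_i=1\}$, $\mathfrak g_\alpha$ the root spaces, $\omega_i^\vee$ the fundamental coweights ($(\omega_i^\vee,\alpha_j)=\delta_{ij}$), $P^\vee$ the coweight lattice, $(\cdot,\cdot)$ the pairing. $X=\{x\in P^\vee\mid(x,\alpha_i)\ge0\ \forall i,\ (x,\theta)\le2\}$. $\Delta_\tau^i=\{\alpha\in\Delta^+\mid(\alpha,\tau)=i\}$, $\mathfrak i_{(\tau)}=\bigoplus_{\alpha\in\Delta_\tau^2}\mathfrak g_\alpha$ (an abelian ideal of $\mathfrak b$ for $\tau\in X$; the abelian ideals of this form are called special), $\mathfrak n_\tau=\sum_{\alpha\in\Delta^+,\,(\alpha,\tau)>0}\mathfrak g_\alpha$. An abelian ideal of $\mathfrak b$ is called nilradical if it is the nilradical of a parabolic subalgebra of $\mathfrak g$, where for a parabolic with Levi decomposition $\mathfrak m\oplus\mathfrak n'$ the nilradical means $\mathfrak n'$. *)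

theory Defs
  imports Complex_Main
begin

text \<open>The ambient Lie algebra is the universe of a type; subalgebras, ideals etc. are subsets of it.\<close>

class complex_lie_algebra = ab_group_add +
  fixes scaleC :: "complex \<Rightarrow> 'a \<Rightarrow> 'a" (infixr "*\<^sub>C" 75)
    and bracket :: "'a \<Rightarrow> 'a \<Rightarrow> 'a"
  assumes scaleC_add_right: "c *\<^sub>C (x + y) = c *\<^sub>C x + c *\<^sub>C y"
    and scaleC_add_left: "(c + d) *\<^sub>C x = c *\<^sub>C x + d *\<^sub>C x"
    and scaleC_scaleC: "c *\<^sub>C d *\<^sub>C x = (c * d) *\<^sub>C x"
    and scaleC_one: "1 *\<^sub>C x = x"
    and bracket_add_left: "bracket (x + y) z = bracket x z + bracket y z"
    and bracket_add_right: "bracket x (y + z) = bracket x y + bracket x z"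
    and bracket_scaleC_left: "bracket (c *\<^sub>C x) y = c *\<^sub>C bracket x y"
    and bracket_scaleC_right: "bracket x (c *\<^sub>C y) = c *\<^sub>C bracket x y"
    and bracket_self: "bracket x x = 0"
    and jacobi: "bracket x (bracket y z) + bracket y (bracket z x) + bracket z (bracket x y) = 0"

global_interpretation complex_lie: vector_space
    "scaleC :: complex \<Rightarrow> 'a \<Rightarrow> 'a::complex_lie_algebra"
  defines csubspace_raw_def: csubspace = complex_lie.subspace
    and cspan_raw_def: cspan = complex_lie.span
  by standard (fact scaleC_add_right scaleC_add_left scaleC_scaleC scaleC_one)+

definition finite_dimensional_lie :: "'a::complex_lie_algebra itself \<Rightarrow> bool" where
  "finite_dimensional_lie _ \<longleftrightarrow> (\<exists>B :: 'a set. finite B \<and> cspan B = UNIV)"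

definition lie_subalgebra :: "'a::complex_lie_algebra set \<Rightarrow> bool" where
  "lie_subalgebra S \<longleftrightarrow> csubspace S \<and> (\<forall>x\<in>S. \<forall>y\<in>S. bracket x y \<in> S)"

text \<open>\<open>lie_ideal I S\<close>: \<open>I\<close> is an ideal of \<open>S\<close>.\<close>

definition lie_ideal :: "'a::complex_lie_algebra set \<Rightarrow> 'a set \<Rightarrow> bool" where
  "lie_ideal I S \<longleftrightarrow> csubspace I \<and> I \<subseteq> S \<and> (\<forall>x\<in>S. \<forall>y\<in>I. bracket x y \<in> I)"

definition abelian_lie :: "'a::complex_lie_algebra set \<Rightarrow> bool" where
  "abelian_lie S \<longleftrightarrow> (\<forall>x\<in>S. \<forall>y\<in>S. bracket x y = 0)"

definition abelian_ideal :: "'a::complex_lie_algebra set \<Rightarrow> 'a set \<Rightarrow> bool" where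
  "abelian_ideal I S \<longleftrightarrow> lie_ideal I S \<and> abelian_lie I"

definition commutator :: "'a::complex_lie_algebra set \<Rightarrow> 'a set \<Rightarrow> 'a set" where
  "commutator A B = cspan {bracket a b | a b. a \<in> A \<and> b \<in> B}"

primrec derived_series :: "'a::complex_lie_algebra set \<Rightarrow> nat \<Rightarrow> 'a set" where
  "derived_series S 0 = S"
| "derived_series S (Suc k) = commutator (derived_series S k) (derived_series S k)"

definition solvable_lie :: "'a::complex_lie_algebra set \<Rightarrow> bool" where
  "solvable_lie S \<longleftrightarrow> (\<exists>k. derived_series S k = {0})"

primrec lower_central_series :: "'a::complex_lie_algebra set \<Rightarrow> nat \<Rightarrow> 'a set" where
  "lower_central_series S 0 = S"
| "lower_central_series S (Suc k) = commutator S (lower_central_series S k)"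

definition nilpotent_lie :: "'a::complex_lie_algebra set \<Rightarrow> bool" where
  "nilpotent_lie S \<longleftrightarrow> (\<exists>k. lower_central_series S k = {0})"

definition simple_lie :: "'a::complex_lie_algebra set \<Rightarrow> bool" where
  "simple_lie S \<longleftrightarrow> lie_subalgebra S \<and> \<not> abelian_lie S \<and> (\<forall>I. lie_ideal I S \<longrightarrow> I = {0} \<or> I = S)"

definition lie_center :: "'a::complex_lie_algebra set \<Rightarrow> 'a set" where
  "lie_center S = {x \<in> S. \<forall>y\<in>S. bracket x y = 0}"

text \<open>The sum of all solvable ideals; in finite dimension this is the largest solvable ideal.\<close>

definition lie_radical :: "'a::complex_lie_algebra set \<Rightarrow> 'a set" where
  "lie_radical S = cspan (\<Union>{I. lie_ideal I S \<and> solvable_lie I})"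

definition reductive_lie :: "'a::complex_lie_algebra set \<Rightarrow> bool" where
  "reductive_lie S \<longleftrightarrow> lie_subalgebra S \<and> lie_radical S = lie_center S"

definition internal_direct_sum ::
    "'a::complex_lie_algebra set \<Rightarrow> 'a set \<Rightarrow> 'a set \<Rightarrow> bool" where
  "internal_direct_sum V A B \<longleftrightarrow> V = {a + b | a b. a \<in> A \<and> b \<in> B} \<and> A \<inter> B = {0}"

definition borel_subalgebra :: "'a::complex_lie_algebra set \<Rightarrow> bool" where
  "borel_subalgebra b \<longleftrightarrow> lie_subalgebra b \<and> solvable_lie b \<and>
     (\<forall>s. lie_subalgebra s \<and> solvable_lie s \<and> b \<subseteq> s \<longrightarrow> s = b)"

definition parabolic_subalgebra :: "'a::complex_lie_algebra set \<Rightarrow> bool" where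
  "parabolic_subalgebra p \<longleftrightarrow> lie_subalgebra p \<and> (\<exists>b. borel_subalgebra b \<and> b \<subseteq> p)"

text \<open>
  For a parabolic \<open>p\<close> of a semisimple Lie algebra this is the decomposition into a reductive Levi
  factor \<open>m\<close> and the nilradical \<open>u\<close> of \<open>p\<close>; the radical of \<open>p\<close> is in general larger than \<open>u\<close>.
\<close>

definition levi_decomposition ::
    "'a::complex_lie_algebra set \<Rightarrow> 'a set \<Rightarrow> 'a set \<Rightarrow> bool" where
  "levi_decomposition p m u \<longleftrightarrow>
     reductive_lie m \<and> lie_ideal u p \<and> nilpotent_lie u \<and> internal_direct_sum p m u"

text \<open>
  The parabolic is not required to be proper, nor to contain \<open>b\<close>. In particular \<open>{0}\<close>, the
  nilradical of a semisimple Lie algebra, is included.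
\<close>

definition nilradical_abelian_ideal :: "'a::complex_lie_algebra set \<Rightarrow> 'a set \<Rightarrow> bool" where
  "nilradical_abelian_ideal I b \<longleftrightarrow> abelian_ideal I b \<and>
     (\<exists>p m. parabolic_subalgebra p \<and> levi_decomposition p m I)"

definition ad_semisimple :: "'a::complex_lie_algebra \<Rightarrow> bool" where
  "ad_semisimple x \<longleftrightarrow> cspan {y. \<exists>c. bracket x y = c *\<^sub>C y} = UNIV"

definition toral_subalgebra :: "'a::complex_lie_algebra set \<Rightarrow> bool" where
  "toral_subalgebra t \<longleftrightarrow> lie_subalgebra t \<and> abelian_lie t \<and> (\<forall>x\<in>t. ad_semisimple x)"

text \<open>The definition used for semisimple Lie algebras over the complex numbers: maximal toral.\<close>

definition cartan_subalgebra :: "'a::complex_lie_algebra set \<Rightarrow> bool" where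
  "cartan_subalgebra h \<longleftrightarrow> toral_subalgebra h \<and> (\<forall>t. toral_subalgebra t \<and> h \<subseteq> t \<longrightarrow> t = h)"

text \<open>
  Linear functionals on the subspace \<open>h\<close> are represented by functions on the whole type that vanish
  outside \<open>h\<close>, so that equality of functionals is equality of functions.
\<close>

definition dual_of :: "'a::complex_lie_algebra set \<Rightarrow> ('a \<Rightarrow> complex) set" where
  "dual_of h = {l. (\<forall>x\<in>h. \<forall>y\<in>h. l (x + y) = l x + l y) \<and>
                   (\<forall>c. \<forall>x\<in>h. l (c *\<^sub>C x) = c * l x) \<and> (\<forall>x. x \<notin> h \<longrightarrow> l x = 0)}"

definition root_space :: "'a::complex_lie_algebra set \<Rightarrow> ('a \<Rightarrow> complex) \<Rightarrow> 'a set" where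
  "root_space h l = {x. \<forall>H\<in>h. bracket H x = l H *\<^sub>C x}"

definition roots :: "'a::complex_lie_algebra set \<Rightarrow> ('a \<Rightarrow> complex) set" where
  "roots h = {\<alpha> \<in> dual_of h. \<alpha> \<noteq> (\<lambda>_. 0) \<and> root_space h \<alpha> \<noteq> {0}}"

text \<open>Simple roots are a family \<open>\<alpha>\<close> indexed by \<open>{1..n}\<close>; its values elsewhere are irrelevant.\<close>

definition nat_comb :: "nat \<Rightarrow> (nat \<Rightarrow> 'a \<Rightarrow> complex) \<Rightarrow> (nat \<Rightarrow> nat) \<Rightarrow> 'a \<Rightarrow> complex" where
  "nat_comb n \<alpha> k = (\<lambda>x. \<Sum>i=1..n. of_nat (k i) * \<alpha> i x)"

definition simple_system ::
    "'a::complex_lie_algebra set \<Rightarrow> nat \<Rightarrow> (nat \<Rightarrow> 'a \<Rightarrow> complex) \<Rightarrow> bool" where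
  "simple_system h n \<alpha> \<longleftrightarrow> \<alpha> ` {1..n} \<subseteq> roots h \<and>
     (\<forall>c. (\<forall>x. (\<Sum>i=1..n. c i * \<alpha> i x) = 0) \<longrightarrow> (\<forall>i\<in>{1..n}. c i = 0)) \<and>
     (\<forall>\<beta>\<in>roots h. \<exists>k. \<beta> = nat_comb n \<alpha> k \<or> \<beta> = (\<lambda>x. - nat_comb n \<alpha> k x))"

definition pos_roots ::
    "'a::complex_lie_algebra set \<Rightarrow> nat \<Rightarrow> (nat \<Rightarrow> 'a \<Rightarrow> complex) \<Rightarrow> ('a \<Rightarrow> complex) set" where
  "pos_roots h n \<alpha> = {\<beta> \<in> roots h. \<exists>k. \<beta> = nat_comb n \<alpha> k}"

definition highest_root ::
    "'a::complex_lie_algebra set \<Rightarrow> nat \<Rightarrow> (nat \<Rightarrow> 'a \<Rightarrow> complex) \<Rightarrow> ('a \<Rightarrow> complex) \<Rightarrow> bool" where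
  "highest_root h n \<alpha> \<theta> \<longleftrightarrow> \<theta> \<in> roots h \<and>
     (\<forall>\<beta>\<in>roots h. \<exists>k. (\<lambda>x. \<theta> x - \<beta> x) = nat_comb n \<alpha> k)"

text \<open>
  Sums of root spaces. Root spaces for distinct roots are linearly independent, so the sum is
  direct.
\<close>

definition root_space_sum ::
    "'a::complex_lie_algebra set \<Rightarrow> ('a \<Rightarrow> complex) set \<Rightarrow> 'a set" where
  "root_space_sum h \<Phi> = cspan (\<Union>\<beta>\<in>\<Phi>. root_space h \<beta>)"

text \<open>Coweights are elements of \<open>h\<close>; the pairing of a coweight with a root is evaluation.\<close>

definition coweight_lattice :: "'a::complex_lie_algebra set \<Rightarrow> 'a set" where
  "coweight_lattice h = {x \<in> h. \<forall>\<beta>\<in>roots h. \<beta> x \<in> \<int>}"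

definition fundamental_coweights ::
    "'a::complex_lie_algebra set \<Rightarrow> nat \<Rightarrow> (nat \<Rightarrow> 'a \<Rightarrow> complex) \<Rightarrow> (nat \<Rightarrow> 'a) \<Rightarrow> bool" where
  "fundamental_coweights h n \<alpha> \<omega> \<longleftrightarrow>
     (\<forall>i\<in>{1..n}. \<omega> i \<in> h \<and> (\<forall>j\<in>{1..n}. \<alpha> j (\<omega> i) = (if i = j then 1 else 0)))"

text \<open>The values compared below are integers, embedded in the complex numbers.\<close>

definition special_coweights ::
    "'a::complex_lie_algebra set \<Rightarrow> nat \<Rightarrow> (nat \<Rightarrow> 'a \<Rightarrow> complex) \<Rightarrow> ('a \<Rightarrow> complex) \<Rightarrow> 'a set" where
  "special_coweights h n \<alpha> \<theta> =
     {x \<in> coweight_lattice h. (\<forall>i\<in>{1..n}. Re (\<alpha> i x) \<ge> 0) \<and> Re (\<theta> x) \<le> 2}"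

definition roots_at_level ::
    "'a::complex_lie_algebra set \<Rightarrow> nat \<Rightarrow> (nat \<Rightarrow> 'a \<Rightarrow> complex) \<Rightarrow> 'a \<Rightarrow> int \<Rightarrow> ('a \<Rightarrow> complex) set" where
  "roots_at_level h n \<alpha> \<tau> i = {\<beta> \<in> pos_roots h n \<alpha>. \<beta> \<tau> = of_int i}"

definition special_ideal ::
    "'a::complex_lie_algebra set \<Rightarrow> nat \<Rightarrow> (nat \<Rightarrow> 'a \<Rightarrow> complex) \<Rightarrow> 'a \<Rightarrow> 'a set" where
  "special_ideal h n \<alpha> \<tau> = root_space_sum h (roots_at_level h n \<alpha> \<tau> 2)"

definition n_sub ::
    "'a::complex_lie_algebra set \<Rightarrow> nat \<Rightarrow> (nat \<Rightarrow> 'a \<Rightarrow> complex) \<Rightarrow> 'a \<Rightarrow> 'a set" where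
  "n_sub h n \<alpha> \<tau> = root_space_sum h {\<beta> \<in> pos_roots h n \<alpha>. Re (\<beta> \<tau>) > 0}"

end

theory Submission
  imports Defs
begin

text \<open>
  Since all coefficients \<open>m i\<close> of \<open>\<theta>\<close> are positive, the condition \<open>\<theta> \<tau> \<le> 2\<close> leaves only the five
  cases. The rest takes place in the grading of the Lie algebra by the eigenvalues \<open>-2, \<dots>, 2\<close> of
  \<open>ad \<tau>\<close>, in which the special ideal is the piece of degree \<open>2\<close>.

  Maximality of the Borel subalgebra makes \<open>h\<close> self-centralizing. The Killing form is positive
  definite on the real span of the fundamental coweights, hence nonzero, hence nondegenerate by
  simplicity; Cartan's criterion is not needed. This gives coroots, and highest weight theory for the
  three-dimensional simple algebra then shows that degree \<open>1\<close> generates degree \<open>2\<close> whenever all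
  simple roots have degree \<open>0\<close> or \<open>1\<close>.

  Conjugacy of Borel subalgebras is not needed either: a parabolic subalgebra \<open>p\<close> with nilradical the
  piece of degree \<open>2\<close> normalizes that piece, which forces \<open>p\<close> into the nonnegative degrees. The
  positive degrees form a solvable ideal there, and the structure of \<open>p\<close> makes this ideal abelian.
  In cases (2) and (3) this contradicts generation in degree \<open>1\<close>; in case (1) degree \<open>1\<close> vanishes,
  and the nonnegative degrees are a parabolic subalgebra with Levi factor the piece of degree \<open>0\<close>.
\<close>

section \<open>Brackets and solvability\<close>

text \<open>Generation in degree 1 rests on a contradiction in degree -2. If brackets of degree 1
  missed part of degree 2, Killing duality would give a nonzero weight vector y of degree -2
  orthogonal to all of them, and invariance turns this into [y, u] = 0 for every u of degree 1. Let
  y have weight -\<gamma>. Simple root vectors of degree 0 preserve both properties of y and lower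
  the height of \<gamma>, so some such y is killed by every simple root vector and is a highest
  weight vector. But (\<gamma>, \<gamma>) > 0 forces (\<gamma>, \<alpha>_i) > 0 for some i, against
  the nonnegativity of highest weights. A simple root of degree 2 would escape this argument, which
  is why case (1) behaves differently.

  The obstacle in the nilradical statement is that p and its Levi factor are arbitrary: p may fail
  to contain b, and neither has to be stable under \<open>h\<close> or \<open>\<tau>\<close>. Only
  the ideal itself is known, so p is controlled through the normalizer of that ideal, which is
  stable under \<open>\<tau>\<close> and can be examined degree by degree.\<close>

lemma bracket_zero [simp]: "bracket 0 x = 0" "bracket x 0 = (0::'a::complex_lie_algebra)"
  using bracket_add_left[of 0 0 x] bracket_add_right[of x 0 0] by auto

lemma bracket_minus [simp]:
  "bracket (- x) y = - bracket x y" "bracket x (- y) = - bracket (x::'a::complex_lie_algebra) y"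
  using bracket_add_left[of "- x" x y] bracket_add_right[of x "- y" y]
  by (simp_all add: eq_neg_iff_add_eq_0)

lemma bracket_diff:
  "bracket (x - y) z = bracket x z - bracket y (z::'a::complex_lie_algebra)"
  "bracket z (x - y) = bracket z x - bracket z y"
  using bracket_add_left[of x "- y" z] bracket_add_right[of z x "- y"] by simp_all

lemma bracket_sum_right:
  "bracket x (\<Sum>i\<in>A. f i) = (\<Sum>i\<in>A. bracket (x::'a::complex_lie_algebra) (f i))"
  by (induction A rule: infinite_finite_induct) (auto simp: bracket_add_right)

lemma bracket_antisym: "bracket x y = - bracket y (x::'a::complex_lie_algebra)"
proof -
  have "bracket (x + y) (x + y) = 0" by (rule bracket_self)
  then show ?thesis
    by (simp add: bracket_add_left bracket_add_right bracket_self[of x] bracket_self[of y] eq_neg_iff_add_eq_0 add.commute)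
qed

lemma bracket_derivation:
  "bracket x (bracket y z) = bracket (bracket x y) z + bracket y (bracket x (z::'a::complex_lie_algebra))"
proof -
  have "bracket z (bracket x y) = - bracket (bracket x y) z" "bracket y (bracket z x) = - bracket y (bracket x z)"
    by (simp_all add: bracket_antisym[of z "bracket x y"] bracket_antisym[of z x])
  then show ?thesis using jacobi[of x y z] by (simp add: algebra_simps)
qed

lemma bracket_bracket_left:
  "bracket (bracket x y) z = bracket x (bracket y z) - bracket y (bracket x (z::'a::complex_lie_algebra))"
  using bracket_derivation[of x y z] by simp

lemmas bracket_linear = bracket_add_left bracket_add_right bracket_diff
  bracket_scaleC_left bracket_scaleC_right

lemmas csubspace_intro = complex_lie.subspaceI
lemmas csubspaceD = complex_lie.subspace_0 complex_lie.subspace_add complex_lie.subspace_diff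
  complex_lie.subspace_scale complex_lie.subspace_neg

lemma csubspace_cspan [simp]: "csubspace (cspan S)"
  by (rule complex_lie.subspace_span)

lemma bracket_cspan:
  assumes "csubspace E" "\<And>a b. a \<in> A \<Longrightarrow> b \<in> B \<Longrightarrow> bracket a b \<in> E"
    and "x \<in> cspan A" "y \<in> cspan B"
  shows "bracket x y \<in> E"
proof -
  have *: "bracket a y \<in> E" if "a \<in> A" for a
    using assms(4)
  proof (induction rule: complex_lie.span_induct_alt)
    case base then show ?case using assms(1) by (simp add: csubspaceD)
  next
    case (step c u v)
    then show ?case using assms(1,2) that by (simp add: bracket_linear csubspaceD)
  qed
  show ?thesis
    using assms(3)
  proof (induction rule: complex_lie.span_induct_alt)
    case base then show ?case using assms(1) by (simp add: csubspaceD)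
  next
    case (step c u v)
    then show ?case using assms(1) * by (simp add: bracket_linear csubspaceD)
  qed
qed

lemma commutator_mono:
  "A \<subseteq> A' \<Longrightarrow> B \<subseteq> B' \<Longrightarrow> commutator A B \<subseteq> commutator A' B'"
  unfolding commutator_def by (rule complex_lie.span_mono) blast

lemma commutator_subset:
  assumes "csubspace E" "\<And>a b. a \<in> A \<Longrightarrow> b \<in> B \<Longrightarrow> bracket a b \<in> E"
  shows "commutator A B \<subseteq> E"
  unfolding commutator_def using assms by (intro complex_lie.span_minimal) auto

lemma bracket_in_commutator: "a \<in> A \<Longrightarrow> b \<in> B \<Longrightarrow> bracket a b \<in> commutator A B"
  unfolding commutator_def by (rule complex_lie.span_base) blast

lemma zero_in_commutator: "0 \<in> commutator A B"
  unfolding commutator_def by (rule complex_lie.span_zero)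

lemma csubspace_commutator: "csubspace (commutator A B)"
  unfolding commutator_def by (rule complex_lie.subspace_span)

section \<open>Derived series and solvability\<close>

lemma derived_series_mono: "S \<subseteq> T \<Longrightarrow> derived_series S k \<subseteq> derived_series T k"
  by (induction k) (simp_all add: commutator_mono)

lemma derived_series_Suc_shift:
  "derived_series S (Suc k) = derived_series (commutator S S) k"
  by (induction k) auto

text \<open>\<open>solvable_lie\<close> asks for equality with {0}. A commutator is a span and
  contains 0, while an arbitrary set at stage 0 need not, so the inclusion is required at a
  successor stage.\<close>

lemma solvable_lieI:
  assumes "derived_series S (Suc k) \<subseteq> {0}"
  shows "solvable_lie S"
proof -
  have "derived_series S (Suc k) = {0}"
    using assms zero_in_commutator by fastforce
  then show ?thesis unfolding solvable_lie_def by blast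
qed

lemma solvable_lie_of_commutator:
  assumes "commutator S S \<subseteq> T" "solvable_lie T"
  shows "solvable_lie S"
proof -
  obtain k where "derived_series T k = {0}" using assms(2) by (auto simp: solvable_lie_def)
  then have "derived_series S (Suc k) \<subseteq> {0}"
    using derived_series_mono[OF assms(1), of k] by (simp only: derived_series_Suc_shift)
  then show ?thesis by (rule solvable_lieI)
qed

text \<open>V absorbs brackets with A, so stage k of the series of A + V lies in D + V, where D is
  stage k of the series of A. Once A is exhausted the series has entered V, and the length of V
  finishes it.\<close>

lemma solvable_lie_add:
  assumes V: "csubspace V" "solvable_lie V" "\<And>x y. x \<in> V \<Longrightarrow> y \<in> V \<Longrightarrow> bracket x y \<in> V"
    and A: "csubspace A" "solvable_lie A" "\<And>x y. x \<in> A \<Longrightarrow> y \<in> V \<Longrightarrow> bracket x y \<in> V"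
      "\<And>x y. x \<in> A \<Longrightarrow> y \<in> A \<Longrightarrow> bracket x y \<in> A"
  shows "solvable_lie {x + y | x y. x \<in> A \<and> y \<in> V}"
proof -
  let ?S = "\<lambda>A. {x + y | x y. x \<in> A \<and> y \<in> V}"
  have D: "csubspace (derived_series A k) \<and> derived_series A k \<subseteq> A" for k
  proof (induction k)
    case (Suc k)
    have "commutator (derived_series A k) (derived_series A k) \<subseteq> A"
      using Suc A(4) by (intro commutator_subset[OF A(1)]) auto
    then show ?case by (simp add: csubspace_commutator)
  qed (use A in auto)
  have S: "csubspace (?S (derived_series A k))" for k
    using complex_lie.subspace_sums[OF D[of k, THEN conjunct1] V(1)] by simp
  have "derived_series (?S A) k \<subseteq> ?S (derived_series A k)" for k
  proof (induction k)
    case (Suc k)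
    have "commutator (?S (derived_series A k)) (?S (derived_series A k)) \<subseteq> ?S (derived_series A (Suc k))"
    proof (rule commutator_subset[OF S], clarify)
      fix a v a' v' assume a: "a \<in> derived_series A k" "a' \<in> derived_series A k" "v \<in> V" "v' \<in> V"
      then have "a \<in> A" "a' \<in> A" using D by blast+
      then have "bracket a v' + bracket v a' + bracket v v' \<in> V"
        using a V A(3)[of a v'] A(3)[of a' v] bracket_antisym[of v a'] by (simp add: csubspaceD)
      moreover have "bracket a a' \<in> derived_series A (Suc k)"
        using a bracket_in_commutator by auto
      moreover have "bracket (a + v) (a' + v') = bracket a a' + (bracket a v' + bracket v a' + bracket v v')"
        by (simp add: bracket_linear)
      ultimately show "\<exists>x y. bracket (a + v) (a' + v') = x + y \<and> x \<in> derived_series A (Suc k) \<and> y \<in> V"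
        by blast
    qed
    then show ?case using commutator_mono[OF Suc Suc] by auto
  qed auto
  moreover obtain k where "derived_series A k = {0}" using A(2) by (auto simp: solvable_lie_def)
  ultimately have k: "derived_series (?S A) k \<subseteq> V" by fastforce
  obtain l where l: "derived_series V l = {0}" using V(2) by (auto simp: solvable_lie_def)
  have "derived_series (?S A) (k + j) = derived_series (derived_series (?S A) k) j" for j
    by (induction j) auto
  then have "derived_series (?S A) (k + l) \<subseteq> {0}"
    using derived_series_mono[OF k, of l] l by simp
  then have "derived_series (?S A) (Suc (k + l)) \<subseteq> {0}"
    unfolding derived_series.simps by (intro commutator_subset complex_lie.subspace_single_0) auto
  then show ?thesis by (rule solvable_lieI)
qed

lemma solvable_lie_subset:
  assumes "T \<subseteq> S" "solvable_lie S" shows "solvable_lie T"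
proof -
  obtain k where "derived_series S k = {0}" using assms(2) by (auto simp: solvable_lie_def)
  then have "derived_series T k \<subseteq> {0}" using derived_series_mono[OF assms(1), of k] by simp
  then have "derived_series T (Suc k) \<subseteq> {0}"
    unfolding derived_series.simps by (intro commutator_subset complex_lie.subspace_single_0) auto
  then show ?thesis by (rule solvable_lieI)
qed

lemma solvable_lie_abelian:
  assumes "abelian_lie S" shows "solvable_lie S"
proof -
  have "derived_series S (Suc 0) \<subseteq> {0}"
    unfolding derived_series.simps using assms
    by (intro commutator_subset complex_lie.subspace_single_0) (auto simp: abelian_lie_def)
  then show ?thesis by (rule solvable_lieI)
qed

lemma subset_sums:
  "csubspace V \<Longrightarrow> A \<subseteq> {x + y | x y. x \<in> A \<and> y \<in> V}"
  "csubspace A \<Longrightarrow> V \<subseteq> {x + y | x y. x \<in> A \<and> y \<in> V}"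
proof -
  assume "csubspace V"
  then have "0 \<in> V" by (rule csubspaceD)
  then show "A \<subseteq> {x + y | x y. x \<in> A \<and> y \<in> V}" by (metis (mono_tags, lifting) add.right_neutral mem_Collect_eq subsetI)
next
  assume "csubspace A"
  then have "0 \<in> A" by (rule csubspaceD)
  then show "V \<subseteq> {x + y | x y. x \<in> A \<and> y \<in> V}" by (metis (mono_tags, lifting) add.left_neutral mem_Collect_eq subsetI)
qed

section \<open>Weight spaces\<close>

lemma csubspace_root_space: "csubspace (root_space h l)"
  by (rule csubspace_intro)
     (auto simp: root_space_def bracket_linear complex_lie.scale_right_distrib complex_lie.scale_left_commute)

lemma bracket_root_space:
  "x \<in> root_space h l \<Longrightarrow> y \<in> root_space h l' \<Longrightarrow> bracket x y \<in> root_space h (\<lambda>H. l H + l' H)"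
  by (simp add: root_space_def bracket_derivation bracket_linear complex_lie.scale_left_distrib)

text \<open>The argument for independence of eigenvectors: with \<open>H\<close> separating c from
  d, the operator \<open>bracket H\<close> minus \<open>d H\<close> kills the component at d and
  keeps a nonzero multiple of the one at c, which shortens the sum. The set \<open>h\<close> is
  arbitrary, so the lemma also serves for a single operator.\<close>

lemma weight_component_mem:
  assumes "finite F" "csubspace E" "\<And>H x. H \<in> h \<Longrightarrow> x \<in> E \<Longrightarrow> bracket H x \<in> E"
    and "\<And>l. l \<in> F \<Longrightarrow> v l \<in> root_space h l"
    and "\<And>l l'. l \<in> F \<Longrightarrow> l' \<in> F \<Longrightarrow> l \<noteq> l' \<Longrightarrow> \<exists>H\<in>h. l H \<noteq> l' H"
    and "(\<Sum>l\<in>F. v l) \<in> E" "l \<in> F"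
  shows "v l \<in> E"
  using assms(1,4-)
proof (induction arbitrary: v l rule: finite_induct)
  case (insert d F)
  have *: "v c \<in> E" if c: "c \<in> F" for c
  proof -
    have "c \<noteq> d" using insert.hyps that by auto
    then obtain H where H: "H \<in> h" "c H \<noteq> d H" using insert.prems(2)[of c d] c by auto
    let ?u = "\<lambda>l. (l H - d H) *\<^sub>C v l"
    have "bracket H (\<Sum>l\<in>insert d F. v l) - d H *\<^sub>C (\<Sum>l\<in>insert d F. v l) \<in> E"
      by (intro csubspaceD assms(2,3) H insert.prems(3))
    moreover have "bracket H (v l) = l H *\<^sub>C v l" if "l \<in> insert d F" for l
      using insert.prems(1)[OF that] H by (auto simp: root_space_def)
    then have "bracket H (\<Sum>l\<in>insert d F. v l) - d H *\<^sub>C (\<Sum>l\<in>insert d F. v l) = (\<Sum>l\<in>F. ?u l)"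
      using insert.hyps
      by (simp add: bracket_sum_right complex_lie.scale_sum_right complex_lie.scale_left_diff_distrib
          sum_subtractf bracket_linear complex_lie.scale_right_distrib)
    ultimately have "(\<Sum>l\<in>F. ?u l) \<in> E" by simp
    moreover have "?u l \<in> root_space h l" if "l \<in> F" for l
      using insert.prems(1)[of l] that by (simp add: csubspaceD csubspace_root_space)
    ultimately have "?u c \<in> E"
      using insert.prems(2) c by (intro insert.IH[of ?u c]) simp_all
    then have "(1 / (c H - d H)) *\<^sub>C ?u c \<in> E" by (rule complex_lie.subspace_scale[OF assms(2)])
    then show ?thesis using H by simp
  qed
  have "(\<Sum>l\<in>insert d F. v l) - (\<Sum>l\<in>F. v l) \<in> E"
    by (intro complex_lie.subspace_diff insert.prems(3) complex_lie.subspace_sum[of E F] assms(2) *)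
  then have "v d \<in> E" using insert.hyps by simp
  then show ?case using insert.prems(4) * by auto
qed auto

lemma cspan_Union_decompose:
  assumes "\<And>l. l \<in> L \<Longrightarrow> csubspace (W l)" "x \<in> cspan (\<Union>l\<in>L. W l)"
  obtains F v where "finite F" "F \<subseteq> L" "\<And>l. l \<in> F \<Longrightarrow> v l \<in> W l" "x = (\<Sum>l\<in>F. v l)"
proof -
  \<comment> \<open>The family is made total, with value 0 outside F, so that one update of
    \<open>v\<close> covers both a new index and an index already in F.\<close>
  have "\<exists>F v. finite F \<and> F \<subseteq> L \<and> (\<forall>l\<in>L. v l \<in> W l) \<and> (\<forall>l. l \<notin> F \<longrightarrow> v l = 0) \<and> x = (\<Sum>l\<in>F. v l)"
    using assms(2)
  proof (induction rule: complex_lie.span_induct_alt)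
    case base
    show ?case by (rule exI[of _ "{}"], rule exI[of _ "\<lambda>_. 0"]) (auto simp: assms csubspaceD)
  next
    case (step c y z)
    then obtain F v l where F: "finite F" "F \<subseteq> L" "\<forall>l\<in>L. v l \<in> W l" "\<forall>l. l \<notin> F \<longrightarrow> v l = 0"
        "z = (\<Sum>l\<in>F. v l)" and l: "l \<in> L" "y \<in> W l" by auto
    let ?v = "v(l := c *\<^sub>C y + v l)"
    have "(\<Sum>l\<in>F. v l) = (\<Sum>l\<in>insert l F. v l)"
      using F by (intro sum.mono_neutral_left) auto
    also have "\<dots> = v l + (\<Sum>l\<in>F - {l}. v l)"
      using F by (subst sum.insert_remove) auto
    finally have "c *\<^sub>C y + z = ?v l + (\<Sum>l\<in>F - {l}. ?v l)"
      using F by (simp add: add.assoc)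
    also have "\<dots> = (\<Sum>l\<in>insert l F. ?v l)"
      using F by (subst sum.insert_remove) auto
    finally show ?case using F l assms
      by (intro exI[of _ "insert l F"] exI[of _ ?v]) (auto intro!: csubspaceD)
  qed
  then show ?thesis using that by blast
qed

text \<open>Commuting operators preserve each other's eigenspaces. Hence the components of a
  simultaneous eigenvector for T, taken along the eigenspaces of a further K, are still eigenvectors
  for T.\<close>

lemma simultaneous_eigenvectors_span:
  assumes "finite T" "\<And>H K. H \<in> T \<Longrightarrow> K \<in> T \<Longrightarrow> bracket H K = 0" "\<And>H. H \<in> T \<Longrightarrow> ad_semisimple H"
  shows "cspan {x. \<forall>H\<in>T. \<exists>c. bracket H x = c *\<^sub>C x} = UNIV"
  using assms
proof (induction rule: finite_induct)
  case empty
  then show ?case by simp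
next
  case (insert K T)
  let ?E = "{x. \<forall>H\<in>insert K T. \<exists>c. bracket H x = c *\<^sub>C x}"
  have "x \<in> cspan ?E" if "\<forall>H\<in>T. \<exists>c. bracket H x = c *\<^sub>C x" for x
  proof -
    obtain a where a: "\<And>H. H \<in> T \<Longrightarrow> bracket H x = a H *\<^sub>C x" using \<open>\<forall>H\<in>T. _ H\<close> by metis
    \<comment> \<open>Constant functions encode eigenvalues:
      \<open>root_space {K} (\<lambda>_. c)\<close> is the c-eigenspace of
      \<open>bracket K\<close>.\<close>
    let ?L = "range (\<lambda>c::complex. \<lambda>_::'a. c)"
    have "{y. \<exists>c. bracket K y = c *\<^sub>C y} \<subseteq> (\<Union>l\<in>?L. root_space {K} l)"
      by (auto simp: root_space_def)
    then have "x \<in> cspan (\<Union>l\<in>?L. root_space {K} l)"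
      using insert.prems(2)[of K] complex_lie.span_mono unfolding ad_semisimple_def by blast
    then obtain F v where F: "finite F" "F \<subseteq> ?L" "\<And>l. l \<in> F \<Longrightarrow> v l \<in> root_space {K} l" "x = (\<Sum>l\<in>F. v l)"
      by (rule cspan_Union_decompose[rotated]) (auto simp: csubspace_root_space)
    have "v l \<in> root_space T a" if "l \<in> F" for l
    proof (rule weight_component_mem[where h = "{K}", OF F(1) csubspace_root_space _ F(3) _ _ that])
      fix H y assume H: "H \<in> {K}" and y: "y \<in> root_space T a"
      have "bracket H' (bracket K y) = a H' *\<^sub>C bracket K y" if "H' \<in> T" for H'
        using bracket_derivation[of H' K y] insert.prems(1)[of H' K] that y
        by (simp add: root_space_def bracket_linear)
      then show "bracket H y \<in> root_space T a" using H by (simp add: root_space_def)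
    next
      fix l l' assume "l \<in> F" "l' \<in> F" "l \<noteq> l'"
      moreover from this obtain c c' where "l = (\<lambda>_. c)" "l' = (\<lambda>_. c')" using F(2) by blast
      ultimately show "\<exists>H\<in>{K}. l H \<noteq> l' H" by auto
    next
      show "(\<Sum>l\<in>F. v l) \<in> root_space T a" using a F(4) by (simp add: root_space_def)
    qed
    then have "v l \<in> ?E" if "l \<in> F" for l
      using F(3) that by (auto simp: root_space_def)
    then show ?thesis unfolding F(4) by (intro complex_lie.span_sum complex_lie.span_base)
  qed
  then have "cspan {x. \<forall>H\<in>T. \<exists>c. bracket H x = c *\<^sub>C x} \<subseteq> cspan ?E"
    by (intro complex_lie.span_minimal) auto
  then show ?case using insert by auto
qed

text \<open>A basis T of \<open>h\<close> suffices, because a simultaneous eigenvector for T is one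
  for its span. The eigenvalue depends linearly on \<open>H\<close> because the eigenvector is
  nonzero.\<close>

lemma weight_basis_exists:
  fixes h :: "'a::complex_lie_algebra set"
  assumes fd: "finite_dimensional_lie TYPE('a)" and tor: "toral_subalgebra h"
  obtains B w where "finite B" "complex_lie.independent B" "cspan B = (UNIV::'a set)"
    "\<And>b. b \<in> B \<Longrightarrow> w b \<in> dual_of h" "\<And>b. b \<in> B \<Longrightarrow> b \<in> root_space h (w b)"
proof -
  obtain B0 :: "'a set" where B0: "finite B0" "cspan B0 = UNIV"
    using fd by (auto simp: finite_dimensional_lie_def)
  have fin: "finite B" if "complex_lie.independent B" for B :: "'a set"
    using complex_lie.independent_span_bound[OF B0(1) that] B0(2) by simp
  obtain T where T: "T \<subseteq> h" "complex_lie.independent T" "h \<subseteq> cspan T"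
    using complex_lie.maximal_independent_subset by blast
  let ?E = "{x. \<forall>H\<in>T. \<exists>c. bracket H x = c *\<^sub>C x}"
  have hsub: "csubspace h" using tor by (simp add: toral_subalgebra_def lie_subalgebra_def)
  have "cspan ?E = UNIV"
    using tor T(1) fin[OF T(2)]
    by (intro simultaneous_eigenvectors_span) (auto simp: toral_subalgebra_def abelian_lie_def subset_eq)
  moreover obtain B where B: "B \<subseteq> ?E" "complex_lie.independent B" "?E \<subseteq> cspan B"
    using complex_lie.maximal_independent_subset[of ?E] by blast
  ultimately have Bspan: "cspan B = UNIV"
    using complex_lie.span_minimal[OF B(3) csubspace_cspan] by blast
  have "\<exists>l\<in>dual_of h. b \<in> root_space h l" if b: "b \<in> B" for b
  proof -
    have b0: "b \<noteq> 0" using b B(2) complex_lie.dependent_zero by blast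
    have "\<exists>c. bracket H b = c *\<^sub>C b" if "H \<in> cspan T" for H
      using that
    proof (induction rule: complex_lie.span_induct_alt)
      case base then show ?case by (intro exI[of _ 0]) simp
    next
      case (step c H K)
      obtain d where "bracket H b = d *\<^sub>C b" using b B(1) step.hyps by blast
      moreover obtain e where "bracket K b = e *\<^sub>C b" using step.IH by blast
      ultimately show ?case by (intro exI[of _ "c * d + e"]) (simp add: bracket_linear complex_lie.scale_left_distrib)
    qed
    then obtain l where l: "\<And>H. H \<in> h \<Longrightarrow> bracket H b = l H *\<^sub>C b" using T(3) by (metis subsetD)
    \<comment> \<open>Extension by 0 outside \<open>h\<close> is the normal form that
      \<open>dual_of\<close> prescribes.\<close>
    let ?l = "\<lambda>H. if H \<in> h then l H else 0"
    have "l (x + y) = l x + l y" if "x \<in> h" "y \<in> h" for x y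
    proof -
      have "l (x + y) *\<^sub>C b = (l x + l y) *\<^sub>C b"
        using l[of x] l[of y] l[of "x + y"] that hsub
        by (simp add: csubspaceD bracket_linear complex_lie.scale_left_distrib)
      then show ?thesis using b0 by simp
    qed
    moreover have "l (c *\<^sub>C x) = c * l x" if "x \<in> h" for c x
    proof -
      have "l (c *\<^sub>C x) *\<^sub>C b = bracket (c *\<^sub>C x) b"
        using that hsub by (simp add: l csubspaceD)
      also have "\<dots> = (c * l x) *\<^sub>C b"
        using l[OF that] by (simp only: bracket_linear complex_lie.scale_scale)
      finally have "l (c *\<^sub>C x) *\<^sub>C b = (c * l x) *\<^sub>C b" .
      then show ?thesis using b0 by simp
    qed
    ultimately have "?l \<in> dual_of h" using hsub by (auto simp: dual_of_def csubspaceD)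
    moreover have "b \<in> root_space h ?l" using l by (simp add: root_space_def)
    ultimately show ?thesis by blast
  qed
  then obtain w where "\<And>b. b \<in> B \<Longrightarrow> w b \<in> dual_of h \<and> b \<in> root_space h (w b)" by metis
  then show ?thesis using that[of B w] B Bspan fin by blast
qed

lemma dual_of_separated:
  assumes "l \<in> dual_of h" "l' \<in> dual_of h" "l \<noteq> l'"
  shows "\<exists>H\<in>h. l H \<noteq> l' H"
proof (rule ccontr)
  assume "\<not> ?thesis"
  then have "l x = l' x" for x using assms by (cases "x \<in> h") (auto simp: dual_of_def)
  then show False using assms(3) by auto
qed

lemma zero_in_dual_of: "(\<lambda>_. 0) \<in> dual_of h"
  by (simp add: dual_of_def)

lemma csubspace_add_line:
  assumes "csubspace b"
  shows "csubspace {u + c *\<^sub>C x | u c. u \<in> b}"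
proof -
  have "{u + c *\<^sub>C x | u c. u \<in> b} = {u + v | u v. u \<in> b \<and> v \<in> cspan {x}}"
    by (auto simp: complex_lie.span_singleton)
  then show ?thesis using complex_lie.subspace_sums[OF assms csubspace_cspan] by simp
qed

text \<open>For \<open>x\<close> centralizing \<open>h\<close> the algebra \<open>b + \<complex>x\<close> has its commutator in \<open>b\<close>, so it is solvable and
  maximality of \<open>b\<close> applies.\<close>

lemma borel_imp_self_centralizing:
  assumes tor: "toral_subalgebra h" and bor: "borel_subalgebra b"
    and ds: "internal_direct_sum b h (root_space_sum h \<Phi>)" and Phi: "\<Phi> \<subseteq> roots h"
    and x: "\<And>H. H \<in> h \<Longrightarrow> bracket H x = 0"
  shows "x \<in> h"
proof -
  let ?N = "root_space_sum h \<Phi>"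
  have b: "csubspace b" "\<And>x y. x \<in> b \<Longrightarrow> y \<in> b \<Longrightarrow> bracket x y \<in> b" "solvable_lie b"
    using bor by (auto simp: borel_subalgebra_def lie_subalgebra_def)
  have beq: "b = {u + v | u v. u \<in> h \<and> v \<in> ?N}" using ds by (simp add: internal_direct_sum_def)
  have h: "csubspace h" using tor by (simp add: toral_subalgebra_def lie_subalgebra_def)
  have N: "csubspace ?N" by (simp add: root_space_sum_def)
  have Nb: "?N \<subseteq> b" using h unfolding beq by (force dest: csubspaceD)
  have xN: "bracket x v \<in> ?N" if "v \<in> ?N" for v
  proof (rule bracket_cspan[OF N])
    show "v \<in> cspan (\<Union>\<beta>\<in>\<Phi>. root_space h \<beta>)" using that by (simp add: root_space_sum_def)
    show "x \<in> cspan {x}" by (simp add: complex_lie.span_base)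
    fix a y assume a: "a \<in> {x}" and y: "y \<in> (\<Union>\<beta>\<in>\<Phi>. root_space h \<beta>)"
    then obtain \<beta> where \<beta>: "\<beta> \<in> \<Phi>" "y \<in> root_space h \<beta>" by auto
    have "x \<in> root_space h (\<lambda>_. 0)" using x by (simp add: root_space_def)
    from bracket_root_space[OF this \<beta>(2)] have "bracket a y \<in> root_space h \<beta>" using a by simp
    then show "bracket a y \<in> ?N" using \<beta>(1) by (auto simp: root_space_sum_def intro: complex_lie.span_base)
  qed
  have xb: "bracket x u \<in> b" if "u \<in> b" for u
  proof -
    obtain H v where u: "u = H + v" "H \<in> h" "v \<in> ?N" using \<open>u \<in> b\<close> beq by auto
    then have "bracket x u = bracket x v" using x[of H] bracket_antisym[of x H] by (simp add: bracket_linear)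
    then show ?thesis using xN[OF u(3)] Nb by auto
  qed
  let ?S = "{u + c *\<^sub>C x | u c. u \<in> b}"
  have S: "csubspace ?S" using csubspace_add_line[OF b(1)] .
  have bS: "b \<subseteq> ?S" by (force intro: exI[of _ 0])
  have SS: "bracket y z \<in> b" if "y \<in> ?S" "z \<in> ?S" for y z
  proof -
    obtain u c where y: "y = u + c *\<^sub>C x" "u \<in> b" using \<open>y \<in> ?S\<close> by auto
    obtain v d where z: "z = v + d *\<^sub>C x" "v \<in> b" using \<open>z \<in> ?S\<close> by auto
    have "bracket y z = bracket u v - d *\<^sub>C bracket x u + c *\<^sub>C bracket x v"
      unfolding y z using bracket_antisym[of u x] by (simp add: bracket_linear bracket_self complex_lie.scale_minus_right)
    then show ?thesis using xb y z b by (simp add: csubspaceD)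
  qed
  have "solvable_lie ?S"
    using commutator_subset[OF b(1) SS] b(3) by (rule solvable_lie_of_commutator)
  moreover have "lie_subalgebra ?S"
    unfolding lie_subalgebra_def using S SS bS by blast
  ultimately have "?S = b" using bor bS by (auto simp: borel_subalgebra_def)
  moreover have "x \<in> ?S" using b(1) by (force dest: csubspaceD intro: exI[of _ 0] exI[of _ 1])
  ultimately obtain H v where xe: "x = H + v" "H \<in> h" "v \<in> ?N" using beq by auto
  \<comment> \<open>It remains to remove v. Being \<open>x - H\<close>, it has weight 0, whereas its
    components have nonzero weights; so every component vanishes.\<close>
  let ?C = "root_space h (\<lambda>_. 0)"
  have "H \<in> ?C" using tor xe(2) by (auto simp: root_space_def toral_subalgebra_def abelian_lie_def)
  moreover have "x \<in> ?C" using x by (simp add: root_space_def)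
  ultimately have "x - H \<in> ?C" by (intro csubspaceD csubspace_root_space)
  then have vC: "v \<in> ?C" using xe by simp
  from xe(3) obtain F u where F: "finite F" "F \<subseteq> \<Phi>" "\<And>l. l \<in> F \<Longrightarrow> u l \<in> root_space h l" "v = (\<Sum>l\<in>F. u l)"
    unfolding root_space_sum_def by (rule cspan_Union_decompose[rotated]) (auto simp: csubspace_root_space)
  have "u l = 0" if l: "l \<in> F" for l
  proof -
    have "u l \<in> ?C"
    proof (rule weight_component_mem[OF F(1) csubspace_root_space _ F(3) _ _ l])
      show "\<And>H x. H \<in> h \<Longrightarrow> x \<in> ?C \<Longrightarrow> bracket H x \<in> ?C" by (simp add: root_space_def)
      show "\<exists>H\<in>h. l H \<noteq> l' H" if "l \<in> F" "l' \<in> F" "l \<noteq> l'" for l l'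
        using that F(2) Phi by (intro dual_of_separated) (auto simp: roots_def)
      show "(\<Sum>l\<in>F. u l) \<in> ?C" using vC F(4) by simp
    qed
    have lr: "l \<in> dual_of h" "l \<noteq> (\<lambda>_. 0)" using l F(2) Phi by (auto simp: roots_def)
    then obtain K where K: "K \<in> h" "l K \<noteq> 0" using dual_of_separated[OF lr(1) zero_in_dual_of] by blast
    then have "l K *\<^sub>C u l = 0" using \<open>u l \<in> ?C\<close> F(3)[OF l] by (auto simp: root_space_def)
    then show ?thesis using K by simp
  qed
  then have "v = 0" using F(4) by simp
  then show ?thesis using xe by simp
qed

section \<open>The Killing form\<close>

text \<open>Fixing one weight basis turns traces, projections and the finiteness of spectra into
  statements about coordinates. Several basis vectors may share a weight, and those of weight 0 are
  the ones lying in \<open>h\<close>.\<close>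

locale split_simple_lie =
  fixes h :: "'a::complex_lie_algebra set" and n :: nat
    and \<alpha> :: "nat \<Rightarrow> 'a \<Rightarrow> complex" and \<omega> :: "nat \<Rightarrow> 'a"
    and B :: "'a set" and w :: "'a \<Rightarrow> 'a \<Rightarrow> complex"
  assumes finite_B: "finite B" and independent_B: "complex_lie.independent B"
    and span_B: "cspan B = UNIV"
    and weight_dual: "b \<in> B \<Longrightarrow> w b \<in> dual_of h"
    and basis_weight: "b \<in> B \<Longrightarrow> b \<in> root_space h (w b)"
    and simple: "simple_lie (UNIV :: 'a set)"
    and h_subspace: "csubspace h"
    and h_abelian: "H \<in> h \<Longrightarrow> K \<in> h \<Longrightarrow> bracket H K = 0"
    and self_centralizing: "(\<And>H. H \<in> h \<Longrightarrow> bracket H x = 0) \<Longrightarrow> x \<in> h"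
    and simple_roots: "simple_system h n \<alpha>"
    and coweights: "fundamental_coweights h n \<alpha> \<omega>"
begin

section \<open>Coordinates in the weight basis\<close>

abbreviation rep :: "'a \<Rightarrow> 'a \<Rightarrow> complex" where
  "rep \<equiv> complex_lie.representation B"

lemma rep_expansion: "(\<Sum>b\<in>B. rep x b *\<^sub>C b) = x"
  by (rule complex_lie.sum_representation_eq[OF independent_B]) (auto simp: span_B finite_B)

lemma rep_add: "rep (x + y) b = rep x b + rep y b"
  using complex_lie.representation_add[OF independent_B, of y x] by (simp add: span_B add.commute)

lemma rep_scale: "rep (c *\<^sub>C x) b = c * rep x b"
  using complex_lie.representation_scale[OF independent_B, of x c] by (simp add: span_B)

lemma rep_zero: "rep 0 b = 0"
  by (simp add: complex_lie.representation_zero)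

lemma rep_sum: "rep (\<Sum>i\<in>A. f i) b = (\<Sum>i\<in>A. rep (f i) b)"
  by (induction A rule: infinite_finite_induct) (auto simp: rep_zero rep_add)

lemma rep_basis: "c \<in> B \<Longrightarrow> rep c b = (if b = c then 1 else 0)"
  by (simp add: complex_lie.representation_basis[OF independent_B])

lemma rep_diff: "rep (x - y) b = rep x b - rep y b"
  using rep_add[of "x - y" y b] by simp

lemma rep_nonzero: "x \<noteq> 0 \<Longrightarrow> \<exists>b\<in>B. rep x b \<noteq> 0"
  using rep_expansion[of x] by (metis (no_types, lifting) complex_lie.scale_zero_left sum.neutral)

lemma bracket_basis: "H \<in> h \<Longrightarrow> b \<in> B \<Longrightarrow> bracket H b = w b H *\<^sub>C b"
  using basis_weight by (auto simp: root_space_def)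

lemma rep_bracket_h:
  assumes "H \<in> h" "b \<in> B" shows "rep (bracket H x) b = w b H * rep x b"
proof -
  have "bracket H x = (\<Sum>c\<in>B. (rep x c * w c H) *\<^sub>C c)"
    by (subst rep_expansion[of x, symmetric])
       (simp add: bracket_sum_right bracket_scaleC_right bracket_basis assms)
  also have "rep \<dots> b = (\<Sum>c\<in>B. if b = c then rep x c * w c H else 0)"
    unfolding rep_sum by (intro sum.cong) (auto simp: rep_scale rep_basis)
  also have "\<dots> = w b H * rep x b" using assms finite_B by simp
  finally show ?thesis .
qed

lemma eigenvalue_weight:
  assumes "H \<in> h" "bracket H x = c *\<^sub>C x" "b \<in> B" "rep x b \<noteq> 0"
  shows "w b H = c"
  using rep_bracket_h[OF assms(1,3), of x] assms by (simp add: rep_scale)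

lemma weight_of_nonzero:
  assumes "l \<in> dual_of h" "x \<in> root_space h l" "b \<in> B" "rep x b \<noteq> 0"
  shows "w b = l"
proof (rule ccontr)
  assume "w b \<noteq> l"
  then obtain H where "H \<in> h" "w b H \<noteq> l H"
    using dual_of_separated[OF weight_dual[OF assms(3)] assms(1)] by blast
  then show False using eigenvalue_weight[of H x "l H" b] assms by (simp add: root_space_def)
qed

lemma basis_nonzero: "b \<in> B \<Longrightarrow> b \<noteq> 0"
  using independent_B complex_lie.dependent_zero by blast

lemma weight_cases: "b \<in> B \<Longrightarrow> w b = (\<lambda>_. 0) \<or> w b \<in> roots h"
  using weight_dual basis_weight basis_nonzero by (fastforce simp: roots_def)

lemma root_is_weight:
  assumes "l \<in> roots h" obtains b where "b \<in> B" "w b = l"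
proof -
  have l: "l \<in> dual_of h" using assms by (simp add: roots_def)
  have "0 \<in> root_space h l" by (simp add: root_space_def)
  then obtain x where x: "x \<in> root_space h l" "x \<noteq> 0" using assms by (auto simp: roots_def)
  then obtain b where "b \<in> B" "rep x b \<noteq> 0" using rep_nonzero by blast
  then show ?thesis using that weight_of_nonzero[OF l x(1)] by blast
qed

definition component :: "('a \<Rightarrow> complex) \<Rightarrow> 'a \<Rightarrow> 'a" where
  "component l x = (\<Sum>b | b \<in> B \<and> w b = l. rep x b *\<^sub>C b)"

lemma component_root_space: "component l x \<in> root_space h l"
  unfolding component_def using basis_weight
  by (intro complex_lie.subspace_sum complex_lie.subspace_scale csubspace_root_space) auto

lemma component_sum: "(\<Sum>l\<in>w ` B. component l x) = x"
  unfolding component_def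
  using sum.group[of B "w ` B" w "\<lambda>b. rep x b *\<^sub>C b"] finite_B by (simp add: rep_expansion)

lemma component_mem:
  assumes "csubspace E" "\<And>H x. H \<in> h \<Longrightarrow> x \<in> E \<Longrightarrow> bracket H x \<in> E" "x \<in> E" "l \<in> w ` B"
  shows "component l x \<in> E"
proof (rule weight_component_mem[of "w ` B" E h "\<lambda>l. component l x" l])
  show "\<exists>H\<in>h. l H \<noteq> l' H" if "l \<in> w ` B" "l' \<in> w ` B" "l \<noteq> l'" for l l'
    using that weight_dual by (intro dual_of_separated) auto
qed (simp_all add: assms finite_B component_root_space component_sum)

lemma root_space_zero: "root_space h (\<lambda>_. 0) = h"
  using self_centralizing h_abelian by (auto simp: root_space_def)

lemma ideal_cases: "lie_ideal I UNIV \<Longrightarrow> I = {0} \<or> I = (UNIV :: 'a set)"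
  using simple by (simp add: simple_lie_def)

lemma center_trivial:
  fixes x :: 'a
  assumes "\<And>y. bracket x y = 0" shows "x = 0"
proof -
  let ?Z = "{x::'a. \<forall>y. bracket x y = 0}"
  have "\<forall>z\<in>UNIV. \<forall>x\<in>?Z. bracket z x \<in> ?Z"
  proof (intro ballI CollectI allI)
    fix z x y assume "x \<in> ?Z"
    then show "bracket (bracket z x) y = 0" using bracket_antisym[of z x] by simp
  qed
  moreover have "csubspace ?Z" by (rule csubspace_intro) (auto simp: bracket_linear)
  ultimately have "lie_ideal ?Z UNIV" unfolding lie_ideal_def by (intro conjI subset_UNIV)
  then have "?Z = {0} \<or> ?Z = UNIV" by (rule ideal_cases)
  moreover have "?Z \<noteq> UNIV" using simple by (auto simp: simple_lie_def abelian_lie_def)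
  moreover have "x \<in> ?Z" using assms by simp
  ultimately show ?thesis by auto
qed

lemma bracket_eq_sum_basis: "bracket x y = (\<Sum>b\<in>B. rep y b *\<^sub>C bracket x b)"
  by (subst rep_expansion[of y, symmetric]) (simp add: bracket_sum_right bracket_scaleC_right)

text \<open>An \<open>H\<close> on which all roots vanish acts by 0 on every basis vector, so it is
  central.\<close>

lemma h_eq_0:
  assumes "H \<in> h" "\<And>l. l \<in> roots h \<Longrightarrow> l H = 0" shows "H = 0"
proof (rule center_trivial)
  fix y
  have "w b H = 0" if "b \<in> B" for b using weight_cases[OF that] assms by auto
  then show "bracket H y = 0"
    unfolding bracket_eq_sum_basis[of H y] using assms by (simp add: bracket_basis)
qed

section \<open>Simple roots and fundamental coweights as dual coordinates on
  \<open>h\<close>\<close>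

lemma alpha_root: "i \<in> {1..n} \<Longrightarrow> \<alpha> i \<in> roots h"
  using simple_roots by (auto simp: simple_system_def)

lemma root_cases:
  assumes "l \<in> roots h"
  obtains k where "l = nat_comb n \<alpha> k" | k where "l = (\<lambda>x. - nat_comb n \<alpha> k x)"
  using simple_roots assms unfolding simple_system_def by blast

lemma nat_comb_inj:
  assumes "\<And>x. (\<Sum>i=1..n. c i * \<alpha> i x) = (\<Sum>i=1..n. d i * \<alpha> i x)" "i \<in> {1..n}"
  shows "c i = d i"
proof -
  have "\<forall>x. (\<Sum>i=1..n. (c i - d i) * \<alpha> i x) = 0"
    using assms(1) by (simp add: left_diff_distrib sum_subtractf)
  then have "\<forall>i\<in>{1..n}. c i - d i = 0"
    using simple_roots unfolding simple_system_def by (elim conjE allE[of _ "\<lambda>i. c i - d i"]) blast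
  then show ?thesis using assms(2) by simp
qed

lemma dual_linear:
  assumes "l \<in> dual_of h"
  shows "x \<in> h \<Longrightarrow> y \<in> h \<Longrightarrow> l (x + y) = l x + l y" "x \<in> h \<Longrightarrow> l (c *\<^sub>C x) = c * l x"
    "l 0 = 0" "x \<in> h \<Longrightarrow> y \<in> h \<Longrightarrow> l (x - y) = l x - l y"
proof -
  show a: "x \<in> h \<Longrightarrow> y \<in> h \<Longrightarrow> l (x + y) = l x + l y" "x \<in> h \<Longrightarrow> l (c *\<^sub>C x) = c * l x" for x y c
    using assms by (auto simp: dual_of_def)
  show "l 0 = 0" using a(2)[of 0 0] h_subspace by (simp add: csubspaceD)
  show "l (x - y) = l x - l y" if "x \<in> h" "y \<in> h"
    using a(1)[of "x - y" y] that h_subspace by (simp add: csubspaceD)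
qed

lemma dual_sum:
  assumes "l \<in> dual_of h" "\<And>i. i \<in> A \<Longrightarrow> f i \<in> h"
  shows "l (\<Sum>i\<in>A. f i) = (\<Sum>i\<in>A. l (f i))"
  using assms(2)
  by (induction A rule: infinite_finite_induct)
     (auto simp: dual_linear[OF assms(1)] complex_lie.subspace_sum[OF h_subspace])

lemma alpha_dual: "i \<in> {1..n} \<Longrightarrow> \<alpha> i \<in> dual_of h"
  using alpha_root by (auto simp: roots_def)

lemma omega_h: "i \<in> {1..n} \<Longrightarrow> \<omega> i \<in> h"
  using coweights by (auto simp: fundamental_coweights_def)

lemma omega_comb_h: "(\<Sum>i=1..n. c i *\<^sub>C \<omega> i) \<in> h"
  using omega_h by (intro complex_lie.subspace_sum complex_lie.subspace_scale h_subspace) auto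

lemma alpha_omega_comb:
  assumes "j \<in> {1..n}" shows "\<alpha> j (\<Sum>i=1..n. c i *\<^sub>C \<omega> i) = c j"
proof -
  have "\<alpha> j (\<Sum>i=1..n. c i *\<^sub>C \<omega> i) = (\<Sum>i=1..n. \<alpha> j (c i *\<^sub>C \<omega> i))"
    using omega_h h_subspace assms by (intro dual_sum alpha_dual) (auto intro: csubspaceD)
  also have "\<dots> = (\<Sum>i=1..n. if i = j then c i else 0)"
    using coweights assms
    by (intro sum.cong) (auto simp: dual_linear[OF alpha_dual] fundamental_coweights_def)
  also have "\<dots> = c j" using assms by (simp del: One_nat_def)
  finally show ?thesis .
qed

lemma h_eqI:
  assumes "H \<in> h" "K \<in> h" "\<And>i. i \<in> {1..n} \<Longrightarrow> \<alpha> i H = \<alpha> i K" shows "H = K"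
proof -
  have "H - K = 0"
  proof (rule h_eq_0)
    show "H - K \<in> h" using assms h_subspace by (simp add: csubspaceD)
    fix l assume "l \<in> roots h"
    moreover have "nat_comb n \<alpha> k (H - K) = 0" for k
      unfolding nat_comb_def using assms
      by (intro sum.neutral) (auto simp: dual_linear[OF alpha_dual])
    ultimately show "l (H - K) = 0" by (auto elim!: root_cases)
  qed
  then show ?thesis by simp
qed

lemma omega_expansion: "H \<in> h \<Longrightarrow> (\<Sum>i=1..n. \<alpha> i H *\<^sub>C \<omega> i) = H"
  by (intro h_eqI omega_comb_h alpha_omega_comb)

text \<open>The real form of \<open>h\<close> is the real span of the fundamental coweights, on which all roots are
  real-valued.\<close>

definition conj_h :: "'a \<Rightarrow> 'a" where
  "conj_h H = (\<Sum>i=1..n. cnj (\<alpha> i H) *\<^sub>C \<omega> i)"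

lemma conj_h_mem: "conj_h H \<in> h"
  unfolding conj_h_def by (rule omega_comb_h)

lemma nat_comb_conj: "nat_comb n \<alpha> k (conj_h H) = cnj (nat_comb n \<alpha> k H)"
  unfolding nat_comb_def conj_h_def cnj_sum
  by (intro sum.cong) (auto simp: alpha_omega_comb simp del: One_nat_def)

lemma root_conj: "l \<in> roots h \<Longrightarrow> l (conj_h H) = cnj (l H)"
  by (erule root_cases) (auto simp: nat_comb_conj)

lemma weight_conj: "b \<in> B \<Longrightarrow> w b (conj_h H) = cnj (w b H)"
  using weight_cases[of b] root_conj by auto

section \<open>Trace, invariance and nondegeneracy\<close>

definition trace :: "('a \<Rightarrow> 'a) \<Rightarrow> complex" where
  "trace f = (\<Sum>b\<in>B. rep (f b) b)"

lemma trace_commute: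
  assumes "\<And>x y. f (x + y) = f x + f y" "\<And>c x. f (c *\<^sub>C x) = c *\<^sub>C f x"
    and "\<And>x y. g (x + y) = g x + g y" "\<And>c x. g (c *\<^sub>C x) = c *\<^sub>C g x"
  shows "trace (\<lambda>x. f (g x)) = trace (\<lambda>x. g (f x))"
proof -
  have *: "rep (f' (g' b)) b = (\<Sum>c\<in>B. rep (g' b) c * rep (f' c) b)"
    if f': "\<And>x y. f' (x + y) = f' x + f' y" "\<And>c x. f' (c *\<^sub>C x) = c *\<^sub>C f' x" for f' g' b
  proof -
    have "f' 0 = 0" using f'(2)[of 0 0] by simp
    then have "f' (\<Sum>c\<in>A. u c) = (\<Sum>c\<in>A. f' (u c))" for A and u :: "'a \<Rightarrow> 'a"
      by (induction A rule: infinite_finite_induct) (auto simp: f')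
    then have "f' (g' b) = (\<Sum>c\<in>B. rep (g' b) c *\<^sub>C f' c)"
      by (subst rep_expansion[of "g' b", symmetric]) (simp add: f')
    then show ?thesis by (simp add: rep_sum rep_scale)
  qed
  have "trace (\<lambda>x. f (g x)) = (\<Sum>b\<in>B. \<Sum>c\<in>B. rep (g b) c * rep (f c) b)"
    unfolding trace_def using *[of f g] assms by simp
  also have "\<dots> = (\<Sum>c\<in>B. \<Sum>b\<in>B. rep (f c) b * rep (g b) c)"
    by (subst sum.swap) (simp add: mult.commute)
  also have "\<dots> = trace (\<lambda>x. g (f x))"
    unfolding trace_def using *[of g f] assms by simp
  finally show ?thesis .
qed

definition killing :: "'a \<Rightarrow> 'a \<Rightarrow> complex" where
  "killing x y = trace (\<lambda>z. bracket x (bracket y z))"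

lemma killing_linear:
  "killing (x + y) z = killing x z + killing y z" "killing z (x + y) = killing z x + killing z y"
  "killing (c *\<^sub>C x) z = c * killing x z" "killing z (c *\<^sub>C x) = c * killing z x"
  "killing (x - y) z = killing x z - killing y z" "killing z (x - y) = killing z x - killing z y"
  "killing 0 z = 0" "killing z 0 = 0"
  by (simp_all add: killing_def trace_def bracket_linear rep_add rep_scale rep_diff rep_zero
      sum.distrib sum_distrib_left sum_subtractf)

lemma killing_sum: "killing x (\<Sum>i\<in>A. f i) = (\<Sum>i\<in>A. killing x (f i))"
  by (induction A rule: infinite_finite_induct) (auto simp: killing_linear)

lemma killing_sym: "killing x y = killing y x"
  unfolding killing_def by (rule trace_commute) (simp_all add: bracket_linear)

text \<open>Both sides expand into two traces. One trace is common, and the other two agree by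
  cyclicity.\<close>

lemma killing_invariant: "killing (bracket x y) z = killing x (bracket y z)"
proof -
  have "trace (\<lambda>v. bracket y (bracket x (bracket z v))) = trace (\<lambda>v. bracket x (bracket z (bracket y v)))"
    using trace_commute[of "bracket y" "\<lambda>v. bracket x (bracket z v)"] by (simp add: bracket_linear)
  then show ?thesis
    by (simp add: killing_def trace_def bracket_bracket_left rep_diff sum_subtractf bracket_linear)
qed

lemma killing_h:
  assumes "H \<in> h" "K \<in> h" shows "killing H K = (\<Sum>b\<in>B. w b H * w b K)"
  unfolding killing_def trace_def
  by (intro sum.cong) (auto simp: bracket_basis assms bracket_linear rep_scale rep_basis)

text \<open>All weights take conjugate values at conjugate points, so the pairing is the sum of the
  squared absolute values of \<open>w b H\<close>. It is positive because some root does not vanish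
  at \<open>H\<close>.\<close>

lemma killing_conj_pos:
  assumes "H \<in> h" "H \<noteq> 0"
  shows "Re (killing H (conj_h H)) > 0" "Im (killing H (conj_h H)) = 0"
proof -
  have eq: "killing H (conj_h H) = of_real (\<Sum>b\<in>B. (norm (w b H))\<^sup>2)"
    using assms by (simp add: killing_h conj_h_mem weight_conj complex_norm_square del: of_real_power)
  obtain l where l: "l \<in> roots h" "l H \<noteq> 0" using h_eq_0[of H] assms by blast
  obtain b where b: "b \<in> B" "w b = l" by (rule root_is_weight[OF l(1)])
  have "(\<Sum>b\<in>B. (norm (w b H))\<^sup>2) > 0"
    using finite_B b l by (intro sum_pos2[of B b]) auto
  then show "Re (killing H (conj_h H)) > 0" unfolding eq by simp
  show "Im (killing H (conj_h H)) = 0" unfolding eq by simp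
qed

text \<open>By invariance the radical is an ideal. Were it everything, positivity would leave only 0
  in \<open>h\<close>; then every element centralizes \<open>h\<close>, hence lies in
  \<open>h\<close>, and the algebra would be abelian.\<close>

lemma killing_nondegenerate:
  assumes "\<And>y. killing x y = 0" shows "x = 0"
proof -
  let ?R = "{x. \<forall>y. killing x y = 0}"
  have "\<forall>z\<in>UNIV. \<forall>x\<in>?R. bracket z x \<in> ?R"
  proof (intro ballI CollectI allI)
    fix z x y assume "x \<in> ?R"
    then show "killing (bracket z x) y = 0"
      using bracket_antisym[of z x] killing_linear(3)[of "-1" "bracket x z" y]
      by (simp add: killing_invariant)
  qed
  moreover have "csubspace ?R" by (rule csubspace_intro) (auto simp: killing_linear)
  ultimately have "lie_ideal ?R UNIV" unfolding lie_ideal_def by (intro conjI subset_UNIV)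
  then have "?R = {0} \<or> ?R = UNIV" by (rule ideal_cases)
  moreover have "?R \<noteq> UNIV"
  proof
    assume R: "?R = UNIV"
    have "H = 0" if "H \<in> h" for H
    proof (rule ccontr)
      assume "H \<noteq> 0"
      moreover have "killing H (conj_h H) = 0" using R by blast
      ultimately show False using killing_conj_pos(1)[OF that] by simp
    qed
    then have "bracket H y = 0" if "H \<in> h" for H y using that bracket_zero(1) by metis
    then have "x \<in> h" for x by (rule self_centralizing)
    then have "abelian_lie (UNIV :: 'a set)" using h_abelian by (auto simp: abelian_lie_def)
    then show False using simple by (simp add: simple_lie_def)
  qed
  moreover have "x \<in> ?R" using assms by simp
  ultimately show ?thesis by auto
qed

text \<open>Moving \<open>H\<close> across the form by invariance gives c + d times the pairing
  equal to 0. Applied with \<open>H\<close> in \<open>h\<close> it separates weights, with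
  \<open>\<tau>\<close> it separates degrees.\<close>

lemma killing_eigenspaces:
  assumes "bracket H x = c *\<^sub>C x" "bracket H y = d *\<^sub>C y" "c + d \<noteq> 0"
  shows "killing x y = 0"
proof -
  have "c * killing x y = killing (bracket H x) y"
    using assms by (simp add: killing_linear)
  also have "\<dots> = - killing (bracket x H) y"
    using bracket_antisym[of H x] killing_linear(3)[of "-1" "bracket x H" y] by simp
  also have "\<dots> = - (d * killing x y)"
    using assms by (simp add: killing_linear killing_invariant)
  finally have "(c + d) * killing x y = 0" by (simp add: algebra_simps)
  then show ?thesis using assms(3) by simp
qed

lemma dual_neg: "l \<in> dual_of h \<Longrightarrow> (\<lambda>x. - l x) \<in> dual_of h"
  by (auto simp: dual_of_def)

text \<open>Some z pairs nontrivially with x. Of its weight components only the one of weight -l can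
  contribute, so that component, rescaled, is the partner.\<close>

lemma killing_partner:
  assumes l: "l \<in> dual_of h" and x: "x \<in> root_space h l" "x \<noteq> 0"
  obtains y where "y \<in> root_space h (\<lambda>H. - l H)" "killing x y = 1"
proof -
  obtain z where z: "killing x z \<noteq> 0" using killing_nondegenerate[of x] x by blast
  have "(\<Sum>l'\<in>w ` B. killing x (component l' z)) \<noteq> 0"
    using z by (simp add: killing_sum[symmetric] component_sum)
  then obtain l' where l': "l' \<in> w ` B" "killing x (component l' z) \<noteq> 0" by (meson sum.neutral)
  have "l' = (\<lambda>H. - l H)"
  proof (rule ccontr)
    assume "l' \<noteq> (\<lambda>H. - l H)"
    then obtain H where "H \<in> h" "l' H \<noteq> - l H"
      using dual_of_separated[of l' h "\<lambda>H. - l H"] dual_neg[OF l] weight_dual l'(1) by blast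
    moreover from this have "l H + l' H \<noteq> 0" by (simp add: add_eq_0_iff)
    ultimately show False
      using killing_eigenspaces[of H x "l H" "component l' z" "l' H"] l'(2) x(1) component_root_space[of l' z]
      by (simp add: root_space_def)
  qed
  then show ?thesis
    using that[of "(1 / killing x (component l' z)) *\<^sub>C component l' z"] component_root_space[of l' z] l'(2)
    by (auto simp: killing_linear complex_lie.subspace_scale[OF csubspace_root_space])
qed

lemma root_neg: "l \<in> roots h \<Longrightarrow> (\<lambda>H. - l H) \<in> roots h"
proof -
  assume l: "l \<in> roots h"
  then have ld: "l \<in> dual_of h" "l \<noteq> (\<lambda>_. 0)" by (auto simp: roots_def)
  obtain x where x: "x \<in> root_space h l" "x \<noteq> 0"
    using l complex_lie.subspace_0[OF csubspace_root_space[of h l]] by (auto simp: roots_def)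
  obtain y where y: "y \<in> root_space h (\<lambda>H. - l H)" "killing x y = 1"
    by (rule killing_partner[OF ld(1) x])
  have "y \<noteq> 0" using y(2) by (auto simp: killing_linear)
  moreover have "(\<lambda>H. - l H) \<noteq> (\<lambda>_. 0)" using ld(2) by (auto simp: fun_eq_iff)
  ultimately show ?thesis using y(1) dual_neg[OF ld(1)] by (auto simp: roots_def)
qed

section \<open>Coroots and highest weights\<close>

text \<open>Normalizing f by \<open>killing e f = 1\<close> makes t = [e, f] the Killing dual of l,
  so l t = (l, l). This is the coroot up to a positive factor, and the missing normalization
  explains the factor 2 in \<open>highest_weight_integral\<close>. Positivity comes from
  \<open>killing t (conj_h t)\<close>, which equals the conjugate of l t.\<close>

lemma coroot_exists:
  assumes l: "l \<in> roots h" and e: "e \<in> root_space h l" "e \<noteq> 0"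
  obtains f where "f \<in> root_space h (\<lambda>H. - l H)" "bracket e f \<in> h"
    "\<And>H. H \<in> h \<Longrightarrow> killing (bracket e f) H = l H"
    "Re (l (bracket e f)) > 0" "Im (l (bracket e f)) = 0"
proof -
  have ld: "l \<in> dual_of h" "l \<noteq> (\<lambda>_. 0)" using l by (auto simp: roots_def)
  obtain f where f: "f \<in> root_space h (\<lambda>H. - l H)" "killing e f = 1"
    using killing_partner[OF ld(1) e] .
  let ?t = "bracket e f"
  have t: "?t \<in> h" using bracket_root_space[OF e(1) f(1)] root_space_zero by simp
  have k: "killing ?t H = l H" if "H \<in> h" for H
  proof -
    have "bracket f H = l H *\<^sub>C f" using f(1) that bracket_antisym[of f H] by (simp add: root_space_def)
    then show ?thesis using f(2) by (simp add: killing_invariant killing_linear)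
  qed
  have "?t \<noteq> 0"
  proof
    assume "?t = 0"
    then have "l H = 0" if "H \<in> h" for H using k[OF that] by (simp add: killing_linear)
    then show False using dual_of_separated[OF ld(1) zero_in_dual_of ld(2)] by auto
  qed
  then have "Re (l (conj_h ?t)) > 0" "Im (l (conj_h ?t)) = 0"
    using killing_conj_pos[OF t] k[OF conj_h_mem] by auto
  then have "Re (l ?t) > 0" "Im (l ?t) = 0" by (auto simp: root_conj[OF l])
  then show ?thesis using that f t k by blast
qed

text \<open>With the usual Cartan element 2t/a of the three-dimensional simple algebra, y has weight
  2\<mu>/a, and the highest weight of a finite string is a natural number.\<close>

lemma highest_weight_integral:
  assumes t: "t \<in> h" "bracket e f = t" "bracket t f = (- a) *\<^sub>C f" "a \<noteq> 0"
    and y: "y \<noteq> 0" "bracket e y = 0" "bracket t y = \<mu> *\<^sub>C y"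
  obtains k :: nat where "2 * \<mu> = of_nat k * a"
proof -
  define Y where "Y k = (bracket f ^^ k) y" for k
  have Y: "Y 0 = y" "Y (Suc k) = bracket f (Y k)" for k by (simp_all add: Y_def)
  have tY: "bracket t (Y k) = (\<mu> - of_nat k * a) *\<^sub>C Y k" for k
  proof (induction k)
    case (Suc k)
    have "bracket t (Y (Suc k)) = bracket (bracket t f) (Y k) + bracket f (bracket t (Y k))"
      unfolding Y by (rule bracket_derivation)
    then show ?case using Suc t(3)
      by (simp add: Y bracket_linear complex_lie.scale_left_diff_distrib complex_lie.scale_left_distrib algebra_simps)
  qed (simp add: Y y)
  \<comment> \<open>The closed form of the recursion c(k+1) = c(k) + \<mu> - k a with c(0) = 0,
    which the next step derives for the action of e on the string.\<close>
  define c where "c k = of_nat k * (\<mu> - (of_nat k - 1) * a / 2)" for k :: nat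
  have eY: "bracket e (Y (Suc k)) = c (Suc k) *\<^sub>C Y k" for k
  proof (induction k)
    case 0
    then show ?case using bracket_derivation[of e f y] t(2) y by (simp add: Y c_def)
  next
    case (Suc k)
    have "bracket e (Y (Suc (Suc k))) = bracket t (Y (Suc k)) + bracket f (bracket e (Y (Suc k)))"
      unfolding Y(2)[of "Suc k"] t(2)[symmetric] by (rule bracket_derivation)
    also have "\<dots> = (\<mu> - of_nat (Suc k) * a + c (Suc k)) *\<^sub>C Y (Suc k)"
      unfolding Suc tY by (simp add: Y(2)[of k] bracket_linear complex_lie.scale_left_distrib)
    also have "\<mu> - of_nat (Suc k) * a + c (Suc k) = c (Suc (Suc k))"
      by (simp add: c_def field_simps)
    finally show ?case .
  qed
  have "\<exists>k. Y k = 0"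
  proof (rule ccontr)
    assume nz: "\<nexists>k. Y k = 0"
    have "\<mu> - of_nat k * a \<in> (\<lambda>b. w b t) ` B" for k
    proof -
      obtain b where "b \<in> B" "rep (Y k) b \<noteq> 0" using nz rep_nonzero by blast
      then show ?thesis using eigenvalue_weight[OF t(1) tY] by force
    qed
    \<comment> \<open>A string that never ended would give t infinitely many eigenvalues, but each
      eigenvalue is the value at t of one of the finitely many weights.\<close>
    then have "range (\<lambda>k::nat. \<mu> - of_nat k * a) \<subseteq> (\<lambda>b. w b t) ` B" by blast
    then have "finite (range (\<lambda>k::nat. \<mu> - of_nat k * a))" using finite_B finite_subset by blast
    moreover have "inj (\<lambda>k::nat. \<mu> - of_nat k * a)" using t(4) by (auto intro!: injI)
    ultimately show False using finite_imageD by blast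
  qed
  then obtain k where k: "Y k = 0" "\<And>j. j < k \<Longrightarrow> Y j \<noteq> 0" using exists_least_iff[of "\<lambda>k. Y k = 0"] by blast
  then obtain j where j: "k = Suc j" using Y(1) y(1) by (cases k) auto
  have "c (Suc j) *\<^sub>C Y j = 0" using eY[of j] k(1) j by simp
  then have "c (Suc j) = 0" using k(2)[of j] j by simp
  moreover have "c (Suc j) = of_nat (Suc j) * (\<mu> - of_nat j * a / 2)" by (simp add: c_def)
  ultimately have "\<mu> - of_nat j * a / 2 = 0" by (simp del: of_nat_Suc)
  then show ?thesis using that[of j] by (simp add: field_simps)
qed

text \<open>A nonzero y would be a highest weight vector of weight -\<gamma>. Since \<gamma> is a
  nonnegative combination of simple roots and (\<gamma>, \<gamma>) > 0, some (\<gamma>, \<alpha>_i)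
  is positive, whereas integrality for \<alpha>_i makes -(\<gamma>, \<alpha>_i) nonnegative.\<close>

lemma simple_annihilated_zero:
  assumes g: "\<gamma> \<in> roots h" "\<gamma> = nat_comb n \<alpha> k"
    and y: "y \<in> root_space h (\<lambda>H. - \<gamma> H)"
    and ann: "\<And>i e. i \<in> {1..n} \<Longrightarrow> e \<in> root_space h (\<alpha> i) \<Longrightarrow> bracket e y = 0"
  shows "y = 0"
proof (rule ccontr)
  assume y0: "y \<noteq> 0"
  have nz: "\<exists>x\<in>root_space h l. x \<noteq> 0" if "l \<in> roots h" for l
    using that complex_lie.subspace_0[OF csubspace_root_space[of h l]] by (auto simp: roots_def)
  obtain x where x: "x \<in> root_space h \<gamma>" "x \<noteq> 0" using nz[OF g(1)] by blast
  obtain x' where x': "bracket x x' \<in> h" "\<And>H. H \<in> h \<Longrightarrow> killing (bracket x x') H = \<gamma> H"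
      "Re (\<gamma> (bracket x x')) > 0"
    using coroot_exists[OF g(1) x] by metis
  let ?s = "bracket x x'"
  \<comment> \<open>\<open>?s\<close> is the Killing dual of \<gamma>, so \<gamma> and
    \<open>\<alpha> i\<close> evaluated at it are the inner products (\<gamma>, \<gamma>) and
    (\<gamma>, \<alpha>_i).\<close>
  have "Re (\<gamma> ?s) = (\<Sum>i=1..n. of_nat (k i) * Re (\<alpha> i ?s))"
    unfolding g(2) nat_comb_def by simp
  then have "\<exists>i\<in>{1..n}. Re (\<alpha> i ?s) > 0"
    using x'(3) by (metis (no_types, lifting) mult_nonneg_nonpos not_le of_nat_0_le_iff sum_nonpos)
  then obtain i where i: "i \<in> {1..n}" "Re (\<alpha> i ?s) > 0" by blast
  obtain e where e: "e \<in> root_space h (\<alpha> i)" "e \<noteq> 0" using nz[OF alpha_root[OF i(1)]] by blast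
  obtain f where f: "f \<in> root_space h (\<lambda>H. - \<alpha> i H)" "bracket e f \<in> h"
    "\<And>H. H \<in> h \<Longrightarrow> killing (bracket e f) H = \<alpha> i H"
    "Re (\<alpha> i (bracket e f)) > 0" "Im (\<alpha> i (bracket e f)) = 0"
    using coroot_exists[OF alpha_root[OF i(1)] e] by metis
  let ?t = "bracket e f" and ?a = "\<alpha> i (bracket e f)"
  have "\<gamma> ?t = \<alpha> i ?s" using x'(2)[OF f(2)] f(3)[OF x'(1)] killing_sym by metis
  moreover have "?a \<noteq> 0" using f(4) by auto
  moreover have "bracket ?t f = (- ?a) *\<^sub>C f" using f(1,2) by (simp add: root_space_def)
  moreover have "bracket ?t y = (- \<gamma> ?t) *\<^sub>C y" using y f(2) by (simp add: root_space_def)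
  ultimately obtain m :: nat where "2 * (- \<alpha> i ?s) = of_nat m * ?a"
    using highest_weight_integral[OF f(2) refl, of "?a" y "- \<gamma> ?t"] y0 ann[OF i(1) e(1)] by metis
  then have "- 2 * Re (\<alpha> i ?s) = of_nat m * Re ?a"
    by (simp add: complex_eq_iff)
  moreover have "of_nat m * Re ?a \<ge> 0" using f(4) by simp
  ultimately show False using i(2) by simp
qed

text \<open>Completing a basis of V through x yields a functional that vanishes on V and is 1 at x.
  Nondegeneracy represents it by some y, since in finite dimension the injective map into the dual
  is onto.\<close>

lemma killing_separates:
  assumes "csubspace V" "x \<notin> V"
  obtains y where "\<And>v. v \<in> V \<Longrightarrow> killing y v = 0" "killing y x = 1"
proof -
  interpret P: finite_dimensional_vector_space_pair scaleC B scaleC B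
    using finite_B independent_B span_B[unfolded cspan_raw_def] by unfold_locales
  obtain T where T: "T \<subseteq> V" "complex_lie.independent T" "V \<subseteq> cspan T"
    using complex_lie.maximal_independent_subset by blast
  have sp: "cspan T = V" using T assms(1) complex_lie.span_minimal by blast
  have ins: "complex_lie.independent (insert x T)"
    using T(2) assms(2) sp by (intro complex_lie.independent_insertI) auto
  obtain E where E: "insert x T \<subseteq> E" "complex_lie.independent E" "UNIV \<subseteq> cspan E"
    by (rule complex_lie.maximal_independent_subset_extend[OF subset_UNIV ins])
  let ?l = "\<lambda>v. complex_lie.representation E v x"
  have l_add: "?l (u + v) = ?l u + ?l v" "?l (c *\<^sub>C u) = c * ?l u" for u v c
  proof -
    have "z \<in> cspan E" for z using E(3) by blast
    then show "?l (u + v) = ?l u + ?l v" "?l (c *\<^sub>C u) = c * ?l u"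
      using complex_lie.representation_add[OF E(2), of v u] complex_lie.representation_scale[OF E(2), of u c]
      by (simp_all add: add.commute)
  qed
  have l0: "?l 0 = 0" by (simp add: complex_lie.representation_zero)
  have lV: "?l v = 0" if "v \<in> V" for v
    using that unfolding sp[symmetric]
  proof (induction rule: complex_lie.span_induct_alt)
    case base then show ?case by (rule l0)
  next
    case (step c u v)
    have "u \<noteq> x" using step.hyps assms(2) sp complex_lie.span_base by blast
    then have "?l u = 0" using step.hyps E(1) complex_lie.representation_basis[OF E(2), of u] by auto
    then show ?case using step by (simp add: l_add)
  qed
  have lx: "?l x = 1" using E(1) complex_lie.representation_basis[OF E(2), of x] by simp
  \<comment> \<open>The functional \<open>killing y\<close> is stored as the vector of its values on
    B. This identifies the dual with the algebra itself, so that injectivity of an endomorphism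
    gives surjectivity.\<close>
  define \<Phi> where "\<Phi> y = (\<Sum>b\<in>B. killing y b *\<^sub>C b)" for y
  have rep\<Phi>: "rep (\<Phi> y) b = killing y b" if "b \<in> B" for y b
  proof -
    have "rep (\<Phi> y) b = (\<Sum>c\<in>B. if b = c then killing y c else 0)"
      unfolding \<Phi>_def rep_sum by (intro sum.cong) (auto simp: rep_scale rep_basis)
    then show ?thesis using that finite_B by simp
  qed
  have kill_exp: "killing y z = (\<Sum>b\<in>B. rep z b * killing y b)" for y z
    by (subst rep_expansion[of z, symmetric]) (simp add: killing_sum killing_linear)
  have lin: "Vector_Spaces.linear scaleC scaleC \<Phi>"
    by unfold_locales
       (auto simp: \<Phi>_def killing_linear complex_lie.scale_left_distrib sum.distrib complex_lie.scale_sum_right)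
  have "inj \<Phi>"
  proof (rule injI)
    fix y z assume "\<Phi> y = \<Phi> z"
    then have "killing y b = killing z b" if "b \<in> B" for b using rep\<Phi>[OF that] by metis
    then have "killing (y - z) u = 0" for u by (simp add: killing_linear kill_exp[of _ u])
    then show "y = z" using killing_nondegenerate[of "y - z"] by simp
  qed
  then have "surj \<Phi>" using P.linear_injective_imp_surjective[OF lin] by simp
  then obtain y where y: "\<Phi> y = (\<Sum>b\<in>B. ?l b *\<^sub>C b)" by (metis surjD)
  have yb: "killing y b = ?l b" if "b \<in> B" for b
  proof -
    have "killing y b = (\<Sum>c\<in>B. if b = c then ?l c else 0)"
      unfolding rep\<Phi>[OF that, symmetric] y rep_sum by (intro sum.cong) (auto simp: rep_scale rep_basis)
    then show ?thesis using that finite_B by simp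
  qed
  have l_sum: "?l (\<Sum>b\<in>A. u b) = (\<Sum>b\<in>A. ?l (u b))" for A and u :: "'a \<Rightarrow> 'a"
    by (induction A rule: infinite_finite_induct) (auto simp: l0 l_add)
  have yl: "killing y z = ?l z" for z
  proof -
    have "?l z = (\<Sum>b\<in>B. rep z b * ?l b)"
      by (subst rep_expansion[of z, symmetric]) (simp add: l_sum l_add)
    then show ?thesis by (simp add: kill_exp[of y z] yb)
  qed
  show ?thesis using that[of y] yl lV lx by auto
qed

end

section \<open>The grading by a coweight\<close>

locale graded_lie = split_simple_lie +
  fixes \<tau> :: 'a
  assumes tau_h: "\<tau> \<in> h"
    and alpha_tau_nat: "i \<in> {1..n} \<Longrightarrow> \<alpha> i \<tau> \<in> \<nat>"
    and root_tau_bound: "l \<in> roots h \<Longrightarrow> Re (l \<tau>) \<le> 2"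
begin

definition grade :: "int \<Rightarrow> 'a set" where
  "grade k = {x. bracket \<tau> x = of_int k *\<^sub>C x}"

text \<open>Stage 0 is the parabolic subalgebra attached to \<open>\<tau>\<close>, and stage 1 turns
  out to be \<open>n_sub\<close>.\<close>

definition filtration :: "int \<Rightarrow> 'a set" where
  "filtration k = cspan (\<Union>j\<in>{k..}. grade j)"

lemma csubspace_grade: "csubspace (grade k)"
  by (rule csubspace_intro)
     (auto simp: grade_def bracket_linear complex_lie.scale_right_distrib complex_lie.scale_left_commute)

lemma csubspace_filtration: "csubspace (filtration k)"
  by (simp add: filtration_def)

lemma grade_bracket: "x \<in> grade i \<Longrightarrow> y \<in> grade j \<Longrightarrow> bracket x y \<in> grade (i + j)"
  by (simp add: grade_def bracket_derivation bracket_linear complex_lie.scale_left_distrib)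

lemma grade_filtration: "j \<ge> k \<Longrightarrow> grade j \<subseteq> filtration k"
  unfolding filtration_def by (auto intro: complex_lie.span_base)

lemma filtration_bracket:
  assumes "x \<in> filtration i" "y \<in> filtration j" shows "bracket x y \<in> filtration (i + j)"
proof (rule bracket_cspan[OF csubspace_filtration _ assms[unfolded filtration_def]])
  fix a b assume "a \<in> (\<Union>k\<in>{i..}. grade k)" "b \<in> (\<Union>k\<in>{j..}. grade k)"
  then obtain i' j' where "i' \<ge> i" "j' \<ge> j" "a \<in> grade i'" "b \<in> grade j'" by auto
  then show "bracket a b \<in> filtration (i + j)"
    using grade_bracket[of a i' b j'] grade_filtration[of "i + j" "i' + j'"] by auto
qed

lemma filtration_mono: "j \<ge> k \<Longrightarrow> filtration j \<subseteq> filtration k"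
  unfolding filtration_def by (intro complex_lie.span_mono UN_mono) auto

lemma nat_comb_tau: "nat_comb n \<alpha> k \<tau> \<in> \<nat>"
proof -
  have "(\<Sum>i\<in>A. of_nat (k i) * \<alpha> i \<tau>) \<in> \<nat>" if "A \<subseteq> {1..n}" for A
    using that alpha_tau_nat by (induction A rule: infinite_finite_induct) (auto intro!: Nats_add Nats_mult)
  then show ?thesis unfolding nat_comb_def by blast
qed

text \<open>The hypothesis bounds degrees only from above; the lower bound is the same bound for the
  opposite root.\<close>

lemma weight_tau:
  assumes "b \<in> B" obtains k :: int where "w b \<tau> = of_int k" "\<bar>k\<bar> \<le> 2"
proof (cases "w b = (\<lambda>_. 0)")
  case True
  then show ?thesis using that[of 0] by simp
next
  case False
  then have r: "w b \<in> roots h" using weight_cases[OF assms] by simp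
  have "\<exists>k::int. w b \<tau> = of_int k"
  proof (rule root_cases[OF r])
    fix k assume "w b = nat_comb n \<alpha> k"
    then show ?thesis using nat_comb_tau[of k] by (auto elim!: Nats_cases intro: exI[of _ "int _"])
  next
    fix k assume k: "w b = (\<lambda>x. - nat_comb n \<alpha> k x)"
    obtain m :: nat where "nat_comb n \<alpha> k \<tau> = of_nat m" using nat_comb_tau[of k] by (auto elim!: Nats_cases)
    then show ?thesis using k by (intro exI[of _ "- int m"]) simp
  qed
  then obtain k :: int where k: "w b \<tau> = of_int k" by blast
  then have "of_int k \<le> (2::real)" "of_int (- k) \<le> (2::real)"
    using root_tau_bound[OF r] root_tau_bound[OF root_neg[OF r]] by auto
  then have "k \<le> 2" "- k \<le> 2" by (simp_all only: of_int_le_numeral_iff)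
  then show ?thesis using that[OF k] by simp
qed

lemma basis_grade: "b \<in> B \<Longrightarrow> w b \<tau> = of_int k \<Longrightarrow> b \<in> grade k"
  using bracket_basis[OF tau_h] by (simp add: grade_def)

lemma grade_weight: "x \<in> grade k \<Longrightarrow> b \<in> B \<Longrightarrow> rep x b \<noteq> 0 \<Longrightarrow> w b \<tau> = of_int k"
  using eigenvalue_weight[OF tau_h] by (simp add: grade_def)

lemma grade_zero: assumes "\<bar>k\<bar> > 2" shows "grade k = {0}"
proof -
  have "x = 0" if "x \<in> grade k" for x
  proof (rule ccontr)
    assume "x \<noteq> 0"
    then obtain b where b: "b \<in> B" "rep x b \<noteq> 0" using rep_nonzero by blast
    then show False using weight_tau[OF b(1)] grade_weight[OF that b] assms by force
  qed
  then show ?thesis using csubspaceD(1)[OF csubspace_grade] by auto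
qed

lemma filtration_2: "filtration 2 = grade 2"
proof
  have "(\<Union>j\<in>{2..}. grade j) \<subseteq> grade 2"
  proof clarify
    fix x j assume "j \<ge> (2::int)" "x \<in> grade j"
    then show "x \<in> grade 2"
      using grade_zero[of j] csubspaceD(1)[OF csubspace_grade] by (cases "j = 2") auto
  qed
  then show "filtration 2 \<subseteq> grade 2"
    unfolding filtration_def by (intro complex_lie.span_minimal csubspace_grade)
qed (rule grade_filtration, simp)

lemma filtration_zero: assumes "k > 2" shows "filtration k = {0}"
proof -
  have "(\<Union>j\<in>{k..}. grade j) \<subseteq> {0}" using grade_zero assms by auto
  then have "filtration k \<subseteq> {0}"
    unfolding filtration_def by (intro complex_lie.span_minimal complex_lie.subspace_single_0)
  then show ?thesis using csubspaceD(1)[OF csubspace_filtration] by auto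
qed

lemma grade_disjoint: assumes "x \<in> grade i" "x \<in> grade j" "i \<noteq> j" shows "x = 0"
proof -
  have "(of_int i - of_int j :: complex) *\<^sub>C x = 0"
    using assms by (simp add: grade_def complex_lie.scale_left_diff_distrib)
  then show ?thesis using assms(3) by simp
qed

text \<open>Indexed by the complex eigenvalue, so that the parts can be summed over the values of
  \<open>w b \<tau>\<close>.\<close>

definition grade_part :: "complex \<Rightarrow> 'a \<Rightarrow> 'a" where
  "grade_part c x = (\<Sum>b | b \<in> B \<and> w b \<tau> = c. rep x b *\<^sub>C b)"

lemma grade_part_sum: "(\<Sum>c\<in>(\<lambda>b. w b \<tau>) ` B. grade_part c x) = x"
  unfolding grade_part_def
  using sum.group[of B "(\<lambda>b. w b \<tau>) ` B" "\<lambda>b. w b \<tau>" "\<lambda>b. rep x b *\<^sub>C b"] finite_B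
  by (simp add: rep_expansion)

lemma grade_part_grade: "grade_part (of_int k) x \<in> grade k"
  unfolding grade_part_def
  by (intro complex_lie.subspace_sum complex_lie.subspace_scale csubspace_grade) (auto intro: basis_grade)

lemma grade_part_mem:
  assumes "csubspace E" "\<And>x. x \<in> E \<Longrightarrow> bracket \<tau> x \<in> E" "x \<in> E" "c \<in> (\<lambda>b. w b \<tau>) ` B"
  shows "grade_part c x \<in> E"
proof -
  \<comment> \<open>The eigenvalues of \<open>\<tau>\<close> as constant functions, so that the
    weight lemma applies with {\<open>\<tau>\<close>} in the role of \<open>h\<close>.\<close>
  let ?F = "(\<lambda>c (_::'a). c) ` (\<lambda>b. w b \<tau>) ` B"
  have "(\<lambda>l. grade_part (l \<tau>) x) (\<lambda>_. c) \<in> E"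
  proof (rule weight_component_mem[of ?F E "{\<tau>}" "\<lambda>l. grade_part (l \<tau>) x" "\<lambda>_. c"])
    show "\<exists>H\<in>{\<tau>}. l H \<noteq> l' H" if "l \<in> ?F" "l' \<in> ?F" "l \<noteq> l'" for l l'
      using that by auto
    show "grade_part (l \<tau>) x \<in> root_space {\<tau>} l" if l: "l \<in> ?F" for l
    proof -
      obtain b where b: "b \<in> B" "l = (\<lambda>_. w b \<tau>)" using l by auto
      obtain k :: int where k: "w b \<tau> = of_int k" by (rule weight_tau[OF b(1)])
      then show ?thesis using grade_part_grade[of k x] b by (simp add: root_space_def grade_def)
    qed
    have "(\<Sum>l\<in>?F. grade_part (l \<tau>) x) = x"
      by (subst sum.reindex) (auto simp: inj_on_def fun_eq_iff grade_part_sum[unfolded image_image] image_image)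
    then show "(\<Sum>l\<in>?F. grade_part (l \<tau>) x) \<in> E" using assms(3) by simp
  qed (use assms finite_B in auto)
  then show ?thesis by simp
qed

text \<open>Degree -k is orthogonal to every degree other than k, so an element also orthogonal to
  degree k lies in the radical of the form.\<close>

lemma killing_grade_zero:
  assumes "x \<in> grade (- k)" "\<And>v. v \<in> grade k \<Longrightarrow> killing x v = 0" shows "x = 0"
proof (rule killing_nondegenerate)
  fix y
  have "killing x b = 0" if b: "b \<in> B" for b
  proof -
    obtain j :: int where j: "w b \<tau> = of_int j" by (rule weight_tau[OF b])
    then have bj: "b \<in> grade j" using basis_grade b by simp
    show ?thesis
    proof (cases "j = k")
      case False
      then show ?thesis
        using killing_eigenspaces[of \<tau> x "of_int (- k)" b "of_int j"] assms(1) bj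
        by (simp add: grade_def flip: of_int_minus of_int_add)
    qed (use bj assms in auto)
  qed
  then show "killing x y = 0"
    by (subst rep_expansion[of y, symmetric]) (simp add: killing_sum killing_linear)
qed

lemma pos_root_tau: "\<beta> \<in> pos_roots h n \<alpha> \<Longrightarrow> \<beta> \<tau> \<in> \<nat>"
  using nat_comb_tau by (auto simp: pos_roots_def)

lemma root_pos_of_tau:
  assumes "\<beta> \<in> roots h" "Re (\<beta> \<tau>) > 0" shows "\<beta> \<in> pos_roots h n \<alpha>"
proof (rule root_cases[OF assms(1)])
  fix k assume "\<beta> = (\<lambda>x. - nat_comb n \<alpha> k x)"
  moreover have "Re (nat_comb n \<alpha> k \<tau>) \<ge> 0" using nat_comb_tau[of k] by (auto elim!: Nats_cases)
  ultimately show ?thesis using assms(2) by simp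
qed (use assms in \<open>auto simp: pos_roots_def\<close>)

text \<open>A positive degree excludes weight 0 and all negative roots, so basis vectors of degree
  at least k belong to positive roots.\<close>

lemma root_space_sum_eq_filtration:
  assumes "k > 0"
  shows "root_space_sum h {\<beta> \<in> pos_roots h n \<alpha>. Re (\<beta> \<tau>) \<ge> of_int k} = filtration k" (is "?L = _")
proof
  have "root_space h \<beta> \<subseteq> filtration k" if \<beta>: "\<beta> \<in> pos_roots h n \<alpha>" "Re (\<beta> \<tau>) \<ge> of_int k" for \<beta>
  proof -
    obtain j :: nat where j: "\<beta> \<tau> = of_nat j" using pos_root_tau[OF \<beta>(1)] by (auto elim!: Nats_cases)
    have "root_space h \<beta> \<subseteq> grade (int j)"
      using j tau_h by (auto simp: root_space_def grade_def)
    moreover have "int j \<ge> k" using \<beta>(2) j by simp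
    ultimately show ?thesis using grade_filtration by blast
  qed
  then show "?L \<subseteq> filtration k"
    unfolding root_space_sum_def by (intro complex_lie.span_minimal csubspace_filtration) auto
  have "x \<in> ?L" if x: "x \<in> grade j" and j: "j \<ge> k" for x j
  proof -
    have "rep x b *\<^sub>C b \<in> ?L" if b: "b \<in> B" for b
    proof (cases "rep x b = 0")
      case True
      then show ?thesis by (simp add: root_space_sum_def complex_lie.span_zero)
    next
      case False
      then have wb: "w b \<tau> = of_int j" using grade_weight[OF x b] by simp
      then have "w b \<noteq> (\<lambda>_. 0)" using assms j by auto
      then have "w b \<in> roots h" using weight_cases[OF b] by simp
      then have "w b \<in> pos_roots h n \<alpha>" using wb j assms by (intro root_pos_of_tau) auto
      then have "b \<in> ?L" unfolding root_space_sum_def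
        using wb j basis_weight[OF b] by (intro complex_lie.span_base) auto
      then show ?thesis by (simp add: root_space_sum_def complex_lie.span_scale)
    qed
    then have "(\<Sum>b\<in>B. rep x b *\<^sub>C b) \<in> ?L"
      unfolding root_space_sum_def by (intro complex_lie.span_sum)
    then show ?thesis by (simp add: rep_expansion)
  qed
  then show "filtration k \<subseteq> ?L"
    unfolding filtration_def by (intro complex_lie.span_minimal) (auto simp: root_space_sum_def)
qed

lemma special_ideal_eq: "special_ideal h n \<alpha> \<tau> = grade 2"
proof -
  have "Re (\<beta> \<tau>) \<ge> of_int 2 \<longleftrightarrow> \<beta> \<tau> = of_int 2" if \<beta>: "\<beta> \<in> pos_roots h n \<alpha>" for \<beta>
  proof -
    obtain j :: nat where j: "\<beta> \<tau> = of_nat j" using pos_root_tau[OF \<beta>] by (auto elim!: Nats_cases)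
    have "real j \<le> 2" using root_tau_bound[of \<beta>] \<beta> j by (simp add: pos_roots_def)
    then have "j \<le> 2" by linarith
    then show ?thesis using j by (auto simp: complex_eq_iff)
  qed
  then have "roots_at_level h n \<alpha> \<tau> 2 = {\<beta> \<in> pos_roots h n \<alpha>. Re (\<beta> \<tau>) \<ge> of_int 2}"
    unfolding roots_at_level_def by blast
  then show ?thesis
    unfolding special_ideal_def using root_space_sum_eq_filtration[of 2] filtration_2 by simp
qed

lemma n_sub_eq: "n_sub h n \<alpha> \<tau> = filtration 1"
proof -
  have "Re (\<beta> \<tau>) > 0 \<longleftrightarrow> Re (\<beta> \<tau>) \<ge> of_int 1" if "\<beta> \<in> pos_roots h n \<alpha>" for \<beta>
    using pos_root_tau[OF that] by (auto elim!: Nats_cases)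
  then have "{\<beta> \<in> pos_roots h n \<alpha>. Re (\<beta> \<tau>) > 0} = {\<beta> \<in> pos_roots h n \<alpha>. Re (\<beta> \<tau>) \<ge> of_int 1}"
    by blast
  then show ?thesis unfolding n_sub_def using root_space_sum_eq_filtration[of 1] by simp
qed

lemma grade_nonzero:
  assumes "grade k \<noteq> {0}" "k > 0"
  obtains \<beta> where "\<beta> \<in> pos_roots h n \<alpha>" "\<beta> \<tau> = of_int k"
proof -
  obtain x where x: "x \<in> grade k" "x \<noteq> 0" using assms csubspaceD(1)[OF csubspace_grade] by blast
  obtain b where b: "b \<in> B" "rep x b \<noteq> 0" using rep_nonzero[OF x(2)] by blast
  have wb: "w b \<tau> = of_int k" using grade_weight[OF x(1) b] .
  then have "w b \<in> roots h" using weight_cases[OF b(1)] assms(2) by auto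
  then have "w b \<in> pos_roots h n \<alpha>" using wb assms(2) by (intro root_pos_of_tau) auto
  then show ?thesis using that wb by blast
qed

lemma root_grade_nonzero:
  assumes "\<beta> \<in> roots h" "\<beta> \<tau> = of_int k" shows "grade k \<noteq> {0}"
proof -
  have "root_space h \<beta> \<subseteq> grade k" using assms(2) tau_h by (auto simp: root_space_def grade_def)
  moreover have "root_space h \<beta> \<noteq> {0}" "0 \<in> root_space h \<beta>"
    using assms(1) csubspaceD(1)[OF csubspace_root_space] by (auto simp: roots_def)
  ultimately show ?thesis by blast
qed

lemma h_grade_0: "h \<subseteq> grade 0"
  using h_abelian tau_h by (auto simp: grade_def)

lemma abelian_grade_2: "abelian_lie (grade 2)"
  using grade_bracket[of _ 2 _ 2] grade_zero[of 4] by (auto simp: abelian_lie_def)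

lemma filtration_0_normalizes: "x \<in> filtration 0 \<Longrightarrow> y \<in> grade 2 \<Longrightarrow> bracket x y \<in> grade 2"
  using filtration_bracket[of x 0 y 2] by (simp add: filtration_2)

lemma pos_sum_filtration_0: "root_space_sum h (pos_roots h n \<alpha>) \<subseteq> filtration 0"
proof -
  have "root_space h \<beta> \<subseteq> filtration 0" if \<beta>: "\<beta> \<in> pos_roots h n \<alpha>" for \<beta>
  proof -
    obtain j :: nat where "\<beta> \<tau> = of_nat j" using pos_root_tau[OF \<beta>] by (auto elim!: Nats_cases)
    then have "root_space h \<beta> \<subseteq> grade (int j)" using tau_h by (auto simp: root_space_def grade_def)
    then show ?thesis using grade_filtration[of 0 "int j"] by auto
  qed
  then show ?thesis
    unfolding root_space_sum_def by (intro complex_lie.span_minimal csubspace_filtration) auto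
qed

section \<open>Generation of degree 2 by degree 1\<close>

text \<open>Induction on the height of the root. A simple root vector of degree 1 kills y by
  hypothesis. One of degree 0 preserves degree 1, so it sends y to a vector with the same properties
  and a root of smaller height, which is 0. Then \<open>simple_annihilated_zero\<close>
  applies.\<close>

lemma generation_aux:
  assumes alpha01: "\<And>i. i \<in> {1..n} \<Longrightarrow> \<alpha> i \<tau> = 0 \<or> \<alpha> i \<tau> = 1"
    and "nat_comb n \<alpha> k \<in> roots h" "nat_comb n \<alpha> k \<tau> = 2"
    and "y \<in> root_space h (\<lambda>H. - nat_comb n \<alpha> k H)" "\<And>u. u \<in> grade 1 \<Longrightarrow> bracket y u = 0"
  shows "y = 0"
  using assms(2-)
proof (induction "\<Sum>i=1..n. k i" arbitrary: k y rule: less_induct)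
  case less
  show ?case
  proof (rule simple_annihilated_zero[OF less.prems(1) refl less.prems(3)])
    fix i e assume i: "i \<in> {1..n}" and e: "e \<in> root_space h (\<alpha> i)"
    have et: "bracket \<tau> e = \<alpha> i \<tau> *\<^sub>C e" using e tau_h by (simp add: root_space_def)
    show "bracket e y = 0"
    proof (cases "\<alpha> i \<tau> = 1")
      case True
      then show ?thesis using less.prems(4)[of e] et bracket_antisym[of e y] by (simp add: grade_def)
    next
      case False
      then have a0: "\<alpha> i \<tau> = 0" using alpha01[OF i] by simp
      then have e0: "e \<in> grade 0" using et by (simp add: grade_def)
      let ?l = "\<lambda>H. \<alpha> i H + - nat_comb n \<alpha> k H"
      show ?thesis
      proof (rule ccontr)
        assume nz: "bracket e y \<noteq> 0"
        have el: "bracket e y \<in> root_space h ?l" by (rule bracket_root_space[OF e less.prems(3)])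
        have "nat_comb n \<alpha> k \<in> dual_of h" using less.prems(1) by (simp add: roots_def)
        then have "?l \<in> dual_of h" using alpha_dual[OF i] by (auto simp: dual_of_def algebra_simps)
        moreover have "?l \<tau> \<noteq> 0" using a0 less.prems(2) by simp
        then have "?l \<noteq> (\<lambda>_. 0)" by metis
        ultimately have lr: "?l \<in> roots h" using el nz by (auto simp: roots_def)
        have lt: "?l \<tau> = - 2" using a0 less.prems(2) by simp
        \<comment> \<open>A nonnegative combination has nonnegative degree, so degree -2 forces the
          negative sign.\<close>
        obtain k' where k': "?l = (\<lambda>x. - nat_comb n \<alpha> k' x)"
        proof (rule root_cases[OF lr])
          fix k' assume "?l = nat_comb n \<alpha> k'"
          then have "?l \<tau> = nat_comb n \<alpha> k' \<tau>" by (rule fun_cong)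
          moreover have "Re (nat_comb n \<alpha> k' \<tau>) \<ge> 0" using nat_comb_tau[of k'] by (auto elim!: Nats_cases)
          ultimately show ?thesis using lt by simp
        qed (use that in blast)
        have eq: "nat_comb n \<alpha> k H = nat_comb n \<alpha> k' H + \<alpha> i H" for H
          using fun_cong[OF k', of H] by (simp add: algebra_simps)
        \<comment> \<open>Written as equal combinations of simple roots, so that independence gives
          the coefficients: only the one at i drops, by 1.\<close>
        have "(\<Sum>j=1..n. of_nat (k j) * \<alpha> j H) = (\<Sum>j=1..n. of_nat (k' j + (if j = i then 1 else 0)) * \<alpha> j H)" for H
        proof -
          have "(\<Sum>j=1..n. of_nat (if j = i then 1 else 0) * \<alpha> j H) = (\<Sum>j=1..n. if j = i then \<alpha> j H else 0)"
            by (intro sum.cong) auto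
          also have "\<dots> = \<alpha> i H" using i by (simp del: One_nat_def)
          finally show ?thesis using eq[of H]
            by (simp add: nat_comb_def distrib_right sum.distrib del: One_nat_def)
        qed
        then have "of_nat (k j) = (of_nat (k' j + (if j = i then 1 else 0)) :: complex)" if "j \<in> {1..n}" for j
          using nat_comb_inj[of "\<lambda>j. of_nat (k j)" "\<lambda>j. of_nat (k' j + (if j = i then 1 else 0))" j] that by blast
        then have kk: "k j = k' j + (if j = i then 1 else 0)" if "j \<in> {1..n}" for j
          using that of_nat_eq_iff by blast
        have "bracket e y = 0"
        proof (rule less.hyps)
          have "(\<Sum>j=1..n. k j) = (\<Sum>j=1..n. k' j) + (\<Sum>j=1..n. if j = i then 1 else 0)"
            using kk by (simp add: sum.distrib del: One_nat_def)
          also have "(\<Sum>j=1..n. if j = i then 1 else 0) = (1::nat)" using i by (simp del: One_nat_def)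
          finally show "(\<Sum>j=1..n. k' j) < (\<Sum>j=1..n. k j)" by simp
          have "nat_comb n \<alpha> k' = (\<lambda>H. - ?l H)" by (rule ext) (simp add: eq)
          then show "nat_comb n \<alpha> k' \<in> roots h" using root_neg[OF lr] by simp
          show "nat_comb n \<alpha> k' \<tau> = 2" using eq[of \<tau>] a0 less.prems(2) by simp
          show "bracket e y \<in> root_space h (\<lambda>H. - nat_comb n \<alpha> k' H)" using el k' by simp
          fix u assume u: "u \<in> grade 1"
          then have "bracket e u \<in> grade 1" using grade_bracket[OF e0 u] by simp
          then show "bracket (bracket e y) u = 0"
            using less.prems(4) u by (simp add: bracket_bracket_left)
        qed
        then show False using nz by simp
      qed
    qed
  qed
qed

text \<open>A y orthogonal to all brackets of degree 1 but not to some x of degree 2 may be replaced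
  by one weight component, which has degree -2. Invariance makes that component commute with degree
  1, and \<open>generation_aux\<close> kills it.\<close>

lemma grade_2_generated:
  assumes alpha01: "\<And>i. i \<in> {1..n} \<Longrightarrow> \<alpha> i \<tau> = 0 \<or> \<alpha> i \<tau> = 1"
  shows "grade 2 = commutator (grade 1) (grade 1)" (is "_ = ?V")
proof
  show V2: "?V \<subseteq> grade 2"
    using grade_bracket[of _ 1 _ 1] by (intro commutator_subset csubspace_grade) auto
  show "grade 2 \<subseteq> ?V"
  proof (rule ccontr)
    assume "\<not> grade 2 \<subseteq> ?V"
    then obtain x where x: "x \<in> grade 2" "x \<notin> ?V" by blast
    obtain y where y: "\<And>v. v \<in> ?V \<Longrightarrow> killing y v = 0" "killing y x = 1"
      using killing_separates[OF csubspace_commutator x(2)] by blast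
    \<comment> \<open>Stability of \<open>?V\<close> under \<open>h\<close> passes to its orthogonal
      space \<open>?E\<close>, which therefore contains the weight components of y.\<close>
    have Vh: "bracket H v \<in> ?V" if H: "H \<in> h" and v: "v \<in> ?V" for H v
    proof (rule bracket_cspan[OF csubspace_commutator, where A = "{H}"])
      show "v \<in> cspan {bracket a b | a b. a \<in> grade 1 \<and> b \<in> grade 1}" using v by (simp add: commutator_def)
      fix H' u assume "H' \<in> {H}" "u \<in> {bracket a b | a b. a \<in> grade 1 \<and> b \<in> grade 1}"
      then obtain a b where u: "u = bracket a b" "a \<in> grade 1" "b \<in> grade 1" and H': "H' = H" by blast
      have "bracket H c \<in> grade 1" if "c \<in> grade 1" for c
        using grade_bracket[of H 0 c 1] that h_grade_0 H by auto
      then have "bracket (bracket H a) b \<in> ?V" "bracket a (bracket H b) \<in> ?V"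
        using u by (auto intro: bracket_in_commutator)
      then show "bracket H' u \<in> ?V"
        unfolding u H' bracket_derivation[of H a b] by (intro csubspaceD(2) csubspace_commutator)
    qed (simp add: complex_lie.span_base)
    let ?E = "{y. \<forall>v\<in>?V. killing y v = 0}"
    have E: "csubspace ?E" by (rule csubspace_intro) (auto simp: killing_linear)
    have Eh: "bracket H z \<in> ?E" if "H \<in> h" "z \<in> ?E" for H z
    proof -
      have "killing (bracket H z) v = 0" if "v \<in> ?V" for v
      proof -
        have "killing (bracket z H) v = 0"
          using Vh[OF \<open>H \<in> h\<close> that] \<open>z \<in> ?E\<close> by (simp add: killing_invariant)
        then show ?thesis
          using bracket_antisym[of H z] killing_linear(3)[of "-1" "bracket z H" v] by simp
      qed
      then show ?thesis by simp
    qed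
    have "(\<Sum>l\<in>w ` B. killing x (component l y)) = 1"
      using y(2) by (simp add: killing_sum[symmetric] component_sum killing_sym)
    then obtain l where l: "l \<in> w ` B" "killing x (component l y) \<noteq> 0" by (metis sum.neutral zero_neq_one)
    let ?y = "component l y"
    have yE: "?y \<in> ?E" by (rule component_mem[OF E Eh _ l(1)]) (use y(1) in auto)
    have yl: "?y \<in> root_space h l" by (rule component_root_space)
    have ly: "l \<tau> = - 2"
    proof (rule ccontr)
      assume "l \<tau> \<noteq> - 2"
      then have "2 + l \<tau> \<noteq> 0" by (simp add: add_eq_0_iff)
      then show False
        using killing_eigenspaces[of \<tau> x 2 ?y "l \<tau>"] l(2) x(1) yl tau_h by (simp add: grade_def root_space_def)
    qed
    have "l \<in> roots h" using l(1) weight_cases ly by fastforce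
    then obtain k where k: "l = (\<lambda>x. - nat_comb n \<alpha> k x)"
    proof (rule root_cases)
      fix k' assume "l = nat_comb n \<alpha> k'"
      moreover have "Re (nat_comb n \<alpha> k' \<tau>) \<ge> 0" using nat_comb_tau[of k'] by (auto elim!: Nats_cases)
      ultimately show ?thesis using ly by simp
    qed (use that in blast)
    have y2: "?y \<in> grade (- 2)" using yl ly tau_h by (simp add: root_space_def grade_def)
    have "?y = 0"
    proof (rule generation_aux[OF alpha01])
      show "nat_comb n \<alpha> k \<in> roots h" using root_neg[OF \<open>l \<in> roots h\<close>] k by simp
      show "nat_comb n \<alpha> k \<tau> = 2" using ly k by simp
      show "?y \<in> root_space h (\<lambda>H. - nat_comb n \<alpha> k H)" using yl k by simp
      fix u assume u: "u \<in> grade 1"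
      show "bracket ?y u = 0"
      \<comment> \<open>The bracket has degree -1, so it suffices to pair it with v of degree 1; the
        pairing equals that of \<open>?y\<close> with [u, v].\<close>
      proof (rule killing_grade_zero[of _ 1])
        show "bracket ?y u \<in> grade (- 1)" using grade_bracket[OF y2 u] by simp
        fix v assume "v \<in> grade 1"
        then have "bracket u v \<in> ?V" using u by (intro bracket_in_commutator)
        then show "killing (bracket ?y u) v = 0" using yE by (simp add: killing_invariant)
      qed
    qed
    then show False using l(2) by (simp add: killing_linear)
  qed
qed

section \<open>The normalizer of degree 2\<close>

text \<open>\<open>\<tau>\<close> is the test element: up to the factor -2, the pairing of x with z
  is that of [x, z] with \<open>\<tau>\<close>, so x is orthogonal to degree 2.\<close>

lemma grade_minus_2_faithful:
  assumes "x \<in> grade (- 2)" "\<And>z. z \<in> grade 2 \<Longrightarrow> bracket x z = 0" shows "x = 0"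
proof (rule killing_grade_zero[OF assms(1)])
  fix z assume z: "z \<in> grade 2"
  have "bracket z \<tau> = (- 2) *\<^sub>C z" using z bracket_antisym[of z \<tau>] by (simp add: grade_def)
  then have "- 2 * killing x z = killing x (bracket z \<tau>)" by (simp only: killing_linear)
  also have "\<dots> = 0" using assms(2)[OF z] killing_invariant[of x z \<tau>] by (simp add: killing_linear)
  finally show "killing x z = 0" by simp
qed

text \<open>The ideal generated by \<open>grade 2\<close> is obtained by applying negative degrees only. If \<open>x\<close> of degree
  \<open>-1\<close> centralizes \<open>grade 2\<close>, it also centralizes all negative degrees, so it is orthogonal to that
  ideal.\<close>

lemma grade_minus_1_faithful:
  assumes ne: "grade 2 \<noteq> {0}" and x: "x \<in> grade (- 1)" "\<And>z. z \<in> grade 2 \<Longrightarrow> bracket x z = 0"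
  shows "x = 0"
proof -
  have neg: "bracket x y = 0" if y: "y \<in> grade j" and j: "j < 0" for y j
  proof (cases "j = - 1")
    case True
    show ?thesis
    proof (rule killing_grade_zero[of _ 2])
      show "bracket x y \<in> grade (- 2)" using grade_bracket[OF x(1) y] True by simp
      fix z assume "z \<in> grade 2"
      then have "killing (bracket y x) z = 0" using x(2) by (simp add: killing_invariant killing_linear)
      then show "killing (bracket x y) z = 0"
        using bracket_antisym[of x y] killing_linear(3)[of "-1" "bracket y x" z] by simp
    qed
  next
    case False
    then show ?thesis using grade_bracket[OF x(1) y] grade_zero[of "- 1 + j"] j by auto
  qed
  define \<S> where "\<S> = {S. csubspace S \<and> grade 2 \<subseteq> S \<and> (\<forall>j<0. \<forall>y\<in>grade j. \<forall>s\<in>S. bracket y s \<in> S)}"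
  define U where "U = \<Inter>\<S>"
  have Usub: "csubspace U" unfolding U_def \<S>_def by (rule csubspace_intro) (auto simp: csubspaceD)
  have U2: "grade 2 \<subseteq> U" by (auto simp: U_def \<S>_def)
  have Uneg: "bracket y s \<in> U" if "j < 0" "y \<in> grade j" "s \<in> U" for j y s
    using that by (auto simp: U_def \<S>_def)
  have Uleast: "U \<subseteq> S" if "S \<in> \<S>" for S using that by (auto simp: U_def)
  \<comment> \<open>Commuting z of degree k past y of degree j < 0 leaves [z, y] of degree k + j <
    k, which is negative or covered by the induction. On \<open>grade 2\<close> the claim holds
    because degree 0 preserves it and positive degrees kill it.\<close>
  have Upos: "\<forall>z\<in>grade (int k). \<forall>u\<in>U. bracket z u \<in> U" for k
  proof (induction k rule: less_induct)
    case (less k)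
    let ?S = "{u \<in> U. \<forall>z\<in>grade (int k). bracket z u \<in> U}"
    have "csubspace ?S"
      by (rule csubspace_intro) (auto simp: bracket_linear csubspaceD[OF Usub])
    moreover have "grade 2 \<subseteq> ?S"
      proof
        fix u assume u: "u \<in> grade 2"
        have "bracket z u \<in> U" if "z \<in> grade (int k)" for z
        proof (cases "k = 0")
          case True
          then show ?thesis using grade_bracket[OF that u] U2 by auto
        next
          case False
          then show ?thesis using grade_bracket[OF that u] grade_zero[of "int k + 2"] csubspaceD(1)[OF Usub] by auto
        qed
        then show "u \<in> ?S" using u U2 by auto
      qed
    moreover have "bracket y s \<in> ?S" if j: "j < 0" and y: "y \<in> grade j" and s: "s \<in> ?S" for j y s
    proof -
      have "bracket z (bracket y s) \<in> U" if z: "z \<in> grade (int k)" for z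
      proof -
        have "bracket z y \<in> grade (int k + j)" by (rule grade_bracket[OF z y])
        then have "bracket (bracket z y) s \<in> U"
          using less[of "nat (int k + j)"] Uneg[of "int k + j"] s j by (cases "int k + j < 0") auto
        moreover have "bracket y (bracket z s) \<in> U" using s z by (intro Uneg[OF j y]) auto
        ultimately show ?thesis unfolding bracket_derivation[of z y s] by (intro csubspaceD(2)[OF Usub])
      qed
      then show ?thesis using Uneg[OF j y] s by auto
    qed
    ultimately have "?S \<in> \<S>" unfolding \<S>_def by blast
    then show ?case using Uleast by blast
  qed
  have "bracket z u \<in> U" if u: "u \<in> U" for z u
  proof -
    have "bracket b u \<in> U" if b: "b \<in> B" for b
    proof -
      obtain j :: int where "w b \<tau> = of_int j" by (rule weight_tau[OF b])
      then have "b \<in> grade j" using basis_grade b by simp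
      then show ?thesis using Uneg[of j b u] Upos[of "nat j"] u by (cases "j < 0") auto
    qed
    then show ?thesis
      using bracket_cspan[OF Usub, of B "{u}" z u] span_B complex_lie.span_base[of u "{u}"] by auto
  qed
  then have "lie_ideal U UNIV" using Usub by (simp add: lie_ideal_def)
  then have "U = {0} \<or> U = UNIV" by (rule ideal_cases)
  then have UU: "U = UNIV" using U2 ne csubspaceD(1)[OF csubspace_grade[of 2]] by auto
  have "csubspace {s. killing x s = 0}" by (rule csubspace_intro) (auto simp: killing_linear)
  moreover have "killing x z = 0" if "z \<in> grade 2" for z
    using killing_eigenspaces[of \<tau> x "- 1" z 2] x(1) that by (simp add: grade_def)
  moreover have "killing x (bracket y s) = 0" if "j < 0" "y \<in> grade j" for j y s
    using neg[OF that(2,1)] killing_invariant[of x y s] by (simp add: killing_linear)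
  ultimately have "{s. killing x s = 0} \<in> \<S>" unfolding \<S>_def by auto
  then have "killing x s = 0" for s using Uleast UU by blast
  then show ?thesis by (rule killing_nondegenerate)
qed

text \<open>The normalizer is stable under \<open>\<tau>\<close>, so it contains the homogeneous
  parts of x. A part of negative degree sends degree 2 both into degree 2 and strictly below it,
  hence to 0, and faithfulness makes that part vanish.\<close>

lemma normalizer_grade_2:
  assumes ne: "grade 2 \<noteq> {0}" and x: "\<And>z. z \<in> grade 2 \<Longrightarrow> bracket x z \<in> grade 2"
  shows "x \<in> filtration 0"
proof -
  let ?N = "{x. \<forall>z\<in>grade 2. bracket x z \<in> grade 2}"
  have N: "csubspace ?N"
    by (rule csubspace_intro) (auto simp: bracket_linear csubspaceD[OF csubspace_grade])
  have Nt: "bracket \<tau> y \<in> ?N" if "y \<in> ?N" for y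
  proof -
    have "bracket \<tau> z \<in> grade 2" if "z \<in> grade 2" for z
      using grade_bracket[of \<tau> 0 z 2] that tau_h h_grade_0 by auto
    then show ?thesis using that by (auto simp: bracket_bracket_left intro!: csubspaceD(3)[OF csubspace_grade])
  qed
  have "grade_part c x \<in> filtration 0" if c: "c \<in> (\<lambda>b. w b \<tau>) ` B" for c
  proof -
    have pN: "grade_part c x \<in> ?N" by (rule grade_part_mem[OF N Nt _ c]) (use x in auto)
    obtain k :: int where k: "c = of_int k" "\<bar>k\<bar> \<le> 2" using c weight_tau by (metis imageE)
    have pk: "grade_part c x \<in> grade k" using grade_part_grade k by simp
    have z: "bracket (grade_part c x) z = 0" if "k < 0" "z \<in> grade 2" for z
      using grade_disjoint[OF grade_bracket[OF pk that(2)], of 2] pN that by auto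
    consider "k \<ge> 0" | "k = - 1" | "k = - 2" using k(2) by linarith
    then show ?thesis
    proof cases
      case 1
      then show ?thesis using pk grade_filtration by blast
    next
      case 2
      have "grade_part c x = 0"
      proof (rule grade_minus_1_faithful[OF ne])
        show "grade_part c x \<in> grade (- 1)" using pk 2 by simp
      qed (use z 2 in simp)
      then show ?thesis using csubspaceD(1)[OF csubspace_filtration] by simp
    next
      case 3
      have "grade_part c x = 0"
      proof (rule grade_minus_2_faithful)
        show "grade_part c x \<in> grade (- 2)" using pk 3 by simp
      qed (use z 3 in simp)
      then show ?thesis using csubspaceD(1)[OF csubspace_filtration] by simp
    qed
  qed
  then have "(\<Sum>c\<in>(\<lambda>b. w b \<tau>) ` B. grade_part c x) \<in> filtration 0"
    by (intro complex_lie.subspace_sum csubspace_filtration)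
  then show ?thesis by (simp add: grade_part_sum)
qed

section \<open>Nilradicals of parabolic subalgebras\<close>

lemma solvable_filtration_1: "solvable_lie (filtration 1)"
proof (rule solvable_lie_of_commutator)
  show "commutator (filtration 1) (filtration 1) \<subseteq> grade 2"
    using filtration_bracket[of _ 1 _ 1] by (intro commutator_subset csubspace_grade) (simp add: filtration_2)
  show "solvable_lie (grade 2)" by (rule solvable_lie_abelian[OF abelian_grade_2])
qed

text \<open>A parabolic \<open>p\<close> with nilradical \<open>grade 2\<close> lies in the normalizer \<open>filtration 0\<close>, so its Borel
  subalgebra absorbs the solvable ideal \<open>filtration 1\<close>. The part of \<open>filtration 1\<close> in the Levi
  factor \<open>m\<close> is a solvable ideal, hence central, which makes \<open>filtration 1\<close> abelian.\<close>

lemma not_nilradical: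
  assumes gen: "grade 2 = commutator (grade 1) (grade 1)" and ne: "grade 2 \<noteq> {0}"
  shows "\<not> nilradical_abelian_ideal (grade 2) b"
proof
  assume "nilradical_abelian_ideal (grade 2) b"
  then obtain p m where p: "parabolic_subalgebra p" and lev: "levi_decomposition p m (grade 2)"
    by (auto simp: nilradical_abelian_ideal_def)
  obtain b' where b': "borel_subalgebra b'" "b' \<subseteq> p" using p by (auto simp: parabolic_subalgebra_def)
  have red: "lie_subalgebra m" "lie_radical m = lie_center m" and idl: "lie_ideal (grade 2) p"
    and ds: "p = {x + y | x y. x \<in> m \<and> y \<in> grade 2}"
    using lev by (auto simp: levi_decomposition_def reductive_lie_def internal_direct_sum_def)
  have p0: "p \<subseteq> filtration 0"
    using idl by (auto simp: lie_ideal_def intro: normalizer_grade_2[OF ne])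
  have norm: "bracket x y \<in> filtration 1" if "x \<in> p" "y \<in> filtration 1" for x y
    using filtration_bracket[of x 0 y 1] that p0 by auto
  have F1: "bracket x y \<in> filtration 1" if "x \<in> filtration 1" "y \<in> filtration 1" for x y
    using filtration_bracket[of x 1 y 1] that filtration_mono[of 1 2] by auto
  have bs: "csubspace b'" "solvable_lie b'" "\<And>x y. x \<in> b' \<Longrightarrow> y \<in> b' \<Longrightarrow> bracket x y \<in> b'"
    using b'(1) by (auto simp: borel_subalgebra_def lie_subalgebra_def)
  let ?s = "{x + y | x y. x \<in> b' \<and> y \<in> filtration 1}"
  have s: "csubspace ?s" by (rule complex_lie.subspace_sums[OF bs(1) csubspace_filtration])
  have "solvable_lie ?s"
    using norm b'(2) F1 by (intro solvable_lie_add csubspace_filtration solvable_filtration_1 bs) auto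
  moreover have "lie_subalgebra ?s"
    unfolding lie_subalgebra_def
  proof (intro conjI s ballI)
    fix x y assume "x \<in> ?s" "y \<in> ?s"
    then obtain a u c v where xy: "x = a + u" "y = c + v" "a \<in> b'" "c \<in> b'" "u \<in> filtration 1" "v \<in> filtration 1"
      by blast
    have "bracket x y = bracket a c + (bracket a v - bracket c u + bracket u v)"
      using bracket_antisym[of u c] by (simp add: xy bracket_linear)
    moreover have "bracket a v - bracket c u + bracket u v \<in> filtration 1"
      using xy b'(2) norm F1 by (intro csubspaceD(2,3) csubspace_filtration) auto
    ultimately show "bracket x y \<in> ?s" using bs(3)[OF xy(3,4)] by blast
  qed
  moreover have "b' \<subseteq> ?s" by (rule subset_sums(1)[OF csubspace_filtration])
  ultimately have "?s = b'" using b'(1) by (simp add: borel_subalgebra_def)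
  with subset_sums(2)[OF bs(1), of "filtration 1"] have "filtration 1 \<subseteq> b'" by (rule ord_le_eq_trans)
  then have F1p: "filtration 1 \<subseteq> p" using b'(2) by (rule subset_trans)
  have mp: "m \<subseteq> p" unfolding ds by (rule subset_sums(1)[OF csubspace_grade])
  have "lie_ideal (m \<inter> filtration 1) m"
    unfolding lie_ideal_def
  proof (intro conjI ballI)
    show "csubspace (m \<inter> filtration 1)"
      using red(1) csubspace_filtration by (simp add: lie_subalgebra_def complex_lie.subspace_inter)
    show "bracket x y \<in> m \<inter> filtration 1" if "x \<in> m" "y \<in> m \<inter> filtration 1" for x y
      using that red(1) norm mp by (auto simp: lie_subalgebra_def)
  qed simp
  moreover have "solvable_lie (m \<inter> filtration 1)"
    by (rule solvable_lie_subset[OF _ solvable_filtration_1]) auto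
  ultimately have "m \<inter> filtration 1 \<subseteq> lie_radical m"
    unfolding lie_radical_def by (auto intro: complex_lie.span_base)
  then have cen: "m \<inter> filtration 1 \<subseteq> lie_center m" using red(2) by simp
  \<comment> \<open>Since \<open>grade 2\<close> lies in \<open>filtration 1\<close>, subtracting
    the \<open>grade 2\<close> part of u leaves an element of \<open>m\<close> in
    \<open>filtration 1\<close>, and such elements are central in \<open>m\<close>.\<close>
  have dec: "\<exists>z i. u = z + i \<and> z \<in> lie_center m \<and> z \<in> filtration 1 \<and> i \<in> grade 2" if u: "u \<in> filtration 1" for u
  proof -
    obtain z i where zi: "u = z + i" "z \<in> m" "i \<in> grade 2" using u F1p ds by blast
    then have "z = u - i" "i \<in> filtration 1" using grade_filtration[of 1 2] by auto
    then have "z \<in> filtration 1" using u by (auto intro: csubspaceD(3)[OF csubspace_filtration])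
    then show ?thesis using zi cen by blast
  qed
  have k0: "bracket u v = 0" if "u \<in> filtration 1" "v \<in> grade 2" for u v
    using filtration_bracket[of u 1 v 2] that filtration_zero[of 3] by (simp add: filtration_2)
  have "bracket u v = 0" if u: "u \<in> filtration 1" and v: "v \<in> filtration 1" for u v
  proof -
    obtain z i where zi: "u = z + i" "z \<in> lie_center m" "z \<in> filtration 1" "i \<in> grade 2" using dec[OF u] by blast
    obtain z' i' where zi': "v = z' + i'" "z' \<in> lie_center m" "z' \<in> filtration 1" "i' \<in> grade 2"
      using dec[OF v] by blast
    have "bracket z z' = 0" using zi(2) zi'(2) by (auto simp: lie_center_def)
    moreover have "bracket z i' = 0" "bracket z' i = 0" using k0 zi zi' by auto
    moreover have "bracket i i' = 0" using abelian_grade_2 zi(4) zi'(4) by (auto simp: abelian_lie_def)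
    ultimately show ?thesis
      using bracket_antisym[of i z'] by (simp add: zi(1) zi'(1) bracket_linear)
  qed
  then have "commutator (grade 1) (grade 1) \<subseteq> {0}"
    using grade_filtration[of 1 1] by (intro commutator_subset complex_lie.subspace_single_0) auto
  then show False using gen ne csubspaceD(1)[OF csubspace_grade[of 2]] by auto
qed

section \<open>Degree 0 as Levi factor\<close>

text \<open>A nonzero x would bring along f and t = [x, f], which span a three-dimensional simple
  algebra. Each of the three is a nonzero multiple of a bracket of two of them, so they survive in
  every derived algebra of R.\<close>

lemma root_vector_not_in_solvable_ideal:
  assumes R: "lie_ideal R (grade 0)" "solvable_lie R"
    and x: "x \<in> R" "x \<in> root_space h \<gamma>" and \<gamma>: "\<gamma> \<in> roots h"
  shows "x = 0"
proof (rule ccontr)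
  assume x0: "x \<noteq> 0"
  have Rs: "csubspace R" "R \<subseteq> grade 0" "\<And>y z. y \<in> grade 0 \<Longrightarrow> z \<in> R \<Longrightarrow> bracket y z \<in> R"
    using R(1) by (auto simp: lie_ideal_def)
  \<comment> \<open>R has degree 0, so \<gamma> vanishes at \<open>\<tau>\<close>; hence f also lies
    in \<open>grade 0\<close>, where R is an ideal.\<close>
  have "\<gamma> \<tau> *\<^sub>C x = 0" using x Rs(2) tau_h by (auto simp: root_space_def grade_def)
  then have \<gamma>0: "\<gamma> \<tau> = 0" using x0 by simp
  obtain f where f: "f \<in> root_space h (\<lambda>H. - \<gamma> H)" "bracket x f \<in> h" "Re (\<gamma> (bracket x f)) > 0"
    using coroot_exists[OF \<gamma> x(2) x0] by metis
  let ?t = "bracket x f" and ?c = "\<gamma> (bracket x f)"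
  have c0: "?c \<noteq> 0" using f(3) by auto
  have f0: "f \<in> grade 0" using f(1) \<gamma>0 tau_h by (simp add: root_space_def grade_def)
  have tR: "?t \<in> R"
    using Rs(3)[OF f0 x(1)] bracket_antisym[of x f] complex_lie.subspace_neg[OF Rs(1)] by metis
  have tx: "bracket ?t x = ?c *\<^sub>C x" using x(2) f(2) by (simp add: root_space_def)
  have tf: "bracket ?t f = (- ?c) *\<^sub>C f" using f(1,2) by (simp add: root_space_def)
  have "bracket f ?t = ?c *\<^sub>C f" using tf bracket_antisym[of f ?t] by simp
  then have "?c *\<^sub>C f \<in> R" using Rs(3)[OF f0 tR] by simp
  then have "(1 / ?c) *\<^sub>C ?c *\<^sub>C f \<in> R" by (rule csubspaceD(4)[OF Rs(1)])
  then have fR: "f \<in> R" using c0 by simp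
  have "x \<in> derived_series R k \<and> f \<in> derived_series R k \<and> ?t \<in> derived_series R k" for k
  proof (induction k)
    case (Suc k)
    let ?D = "derived_series R (Suc k)"
    have D: "csubspace ?D" by (simp add: csubspace_commutator)
    have br: "bracket ?t x \<in> ?D" "bracket ?t f \<in> ?D" "?t \<in> ?D"
      using Suc by (auto intro: bracket_in_commutator)
    have "(1 / ?c) *\<^sub>C bracket ?t x \<in> ?D" "(- 1 / ?c) *\<^sub>C bracket ?t f \<in> ?D"
      by (intro csubspaceD(4)[OF D] br)+
    then show ?case using br c0 unfolding tx tf by simp
  qed (use x tR fR in simp)
  then have "x \<in> {0}" using R(2) unfolding solvable_lie_def by metis
  then show False using x0 by simp
qed

text \<open>A solvable ideal R contains the weight components of its elements, and those at roots
  vanish, so R lies in \<open>h\<close>. If r in R acted nontrivially on a basis vector b of degree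
  0, then [b, r], a nonzero multiple of b, would put a root vector into R. So R is central.\<close>

lemma reductive_grade_0: "reductive_lie (grade 0)"
proof -
  have sub: "bracket x y \<in> grade 0" if "x \<in> grade 0" "y \<in> grade 0" for x y
    using grade_bracket[OF that] by simp
  have cs: "csubspace (lie_center (grade 0))"
    by (rule csubspace_intro) (auto simp: lie_center_def bracket_linear csubspaceD[OF csubspace_grade])
  have "lie_ideal (lie_center (grade 0)) (grade 0)"
    unfolding lie_ideal_def
  proof (intro conjI cs ballI)
    fix x y assume xy: "x \<in> grade 0" "y \<in> lie_center (grade 0)"
    then have "bracket x y = 0" using bracket_antisym[of x y] by (simp add: lie_center_def)
    then show "bracket x y \<in> lie_center (grade 0)" using csubspaceD(1)[OF cs] by simp
  qed (auto simp: lie_center_def)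
  moreover have "solvable_lie (lie_center (grade 0))"
    by (rule solvable_lie_abelian) (auto simp: abelian_lie_def lie_center_def)
  ultimately have ge: "lie_center (grade 0) \<subseteq> lie_radical (grade 0)"
    unfolding lie_radical_def by (auto intro: complex_lie.span_base)
  have "R \<subseteq> lie_center (grade 0)" if R: "lie_ideal R (grade 0)" "solvable_lie R" for R
  proof
    fix r assume r: "r \<in> R"
    have Rs: "csubspace R" "R \<subseteq> grade 0" "\<And>y z. y \<in> grade 0 \<Longrightarrow> z \<in> R \<Longrightarrow> bracket y z \<in> R"
      using R(1) by (auto simp: lie_ideal_def)
    have "component l r \<in> h" if l: "l \<in> w ` B" for l
    proof (cases "l = (\<lambda>_. 0)")
      case True
      then show ?thesis using component_root_space[of l r] root_space_zero by simp
    next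
      case False
      then have "l \<in> roots h" using weight_cases l by blast
      moreover have "component l r \<in> R"
        using h_grade_0 by (intro component_mem[OF Rs(1) Rs(3) r l]) auto
      ultimately have "component l r = 0"
        using root_vector_not_in_solvable_ideal[OF R _ component_root_space] by blast
      then show ?thesis using csubspaceD(1)[OF h_subspace] by simp
    qed
    then have "(\<Sum>l\<in>w ` B. component l r) \<in> h" by (intro complex_lie.subspace_sum h_subspace)
    then have rh: "r \<in> h" by (simp add: component_sum)
    have "bracket r y = 0" if y: "y \<in> grade 0" for y
    proof -
      have "rep y b *\<^sub>C bracket r b = 0" if b: "b \<in> B" for b
      proof (rule ccontr)
        assume nz: "rep y b *\<^sub>C bracket r b \<noteq> 0"
        then have "w b \<tau> = 0" using grade_weight[OF y b] by auto
        then have b0: "b \<in> grade 0" using basis_grade[OF b, of 0] by simp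
        have c: "w b r \<noteq> 0" using nz bracket_basis[OF rh b] by auto
        then have wr: "w b \<in> roots h" using weight_cases[OF b] by auto
        have "bracket b r \<in> R" by (rule Rs(3)[OF b0 r])
        then have "(- 1 / w b r) *\<^sub>C bracket b r \<in> R" by (rule csubspaceD(4)[OF Rs(1)])
        then have "b \<in> R" using bracket_antisym[of b r] bracket_basis[OF rh b] c by simp
        then have "b = 0" by (rule root_vector_not_in_solvable_ideal[OF R _ basis_weight[OF b] wr])
        then show False using basis_nonzero[OF b] by simp
      qed
      then show ?thesis unfolding bracket_eq_sum_basis[of r y] by (rule sum.neutral[OF ballI])
    qed
    then show "r \<in> lie_center (grade 0)" using r Rs(2) by (auto simp: lie_center_def)
  qed
  then have "lie_radical (grade 0) \<subseteq> lie_center (grade 0)"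
    unfolding lie_radical_def by (intro complex_lie.span_minimal cs) auto
  then show ?thesis
    using ge sub csubspace_grade by (auto simp: reductive_lie_def lie_subalgebra_def)
qed

text \<open>Without degree 1, the nonnegative degrees are the sum of degrees 0 and 2, which is the
  required Levi decomposition.\<close>

lemma nilradical_grade_2:
  assumes g1: "grade 1 = {0}" and b: "borel_subalgebra b" "b \<subseteq> filtration 0"
    and ab: "abelian_ideal (grade 2) b"
  shows "nilradical_abelian_ideal (grade 2) b"
proof -
  let ?p = "filtration 0"
  have "lie_subalgebra ?p"
    using filtration_bracket[of _ 0 _ 0] by (simp add: lie_subalgebra_def csubspace_filtration)
  then have "parabolic_subalgebra ?p" using b by (auto simp: parabolic_subalgebra_def)
  moreover have "levi_decomposition ?p (grade 0) (grade 2)"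
    unfolding levi_decomposition_def internal_direct_sum_def
  proof (intro conjI reductive_grade_0)
    show "lie_ideal (grade 2) ?p"
      using filtration_0_normalizes grade_filtration[of 0 2] by (auto simp: lie_ideal_def csubspace_grade)
    have "lower_central_series (grade 2) (Suc 0) \<subseteq> {0}"
      unfolding lower_central_series.simps using abelian_grade_2
      by (intro commutator_subset complex_lie.subspace_single_0) (auto simp: abelian_lie_def)
    then have "lower_central_series (grade 2) (Suc 0) = {0}"
      using zero_in_commutator by fastforce
    then show "nilpotent_lie (grade 2)" unfolding nilpotent_lie_def by blast
    let ?s = "{x + y | x y. x \<in> grade 0 \<and> y \<in> grade 2}"
    have s: "csubspace ?s" by (rule complex_lie.subspace_sums[OF csubspace_grade csubspace_grade])
    have z: "0 \<in> grade k" for k by (rule csubspaceD(1)[OF csubspace_grade])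
    have "grade j \<subseteq> ?s" if j: "j \<ge> 0" for j
    proof -
      consider "j = 0" | "j = 1" | "j = 2" | "j > 2" using j by linarith
      then show ?thesis
      proof cases
        case 4
        then show ?thesis using grade_zero[of j] csubspaceD(1)[OF s] by auto
      next
        case 2
        then show ?thesis using g1 csubspaceD(1)[OF s] by simp
      qed (use subset_sums[OF csubspace_grade] in auto)
    qed
    then have "?p \<subseteq> ?s"
      unfolding filtration_def by (intro complex_lie.span_minimal s) auto
    moreover have "?s \<subseteq> ?p"
      using grade_filtration[of 0 0] grade_filtration[of 0 2]
      by (auto intro!: csubspaceD(2)[OF csubspace_filtration])
    ultimately show "?p = ?s" by blast
    show "grade 0 \<inter> grade 2 = {0}" using grade_disjoint[of _ 0 2] z by auto
  qed
  ultimately show ?thesis using ab unfolding nilradical_abelian_ideal_def by blast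
qed

end

section \<open>Special coweights\<close>

lemma sum_support:
  fixes f :: "nat \<Rightarrow> 'b::comm_monoid_add"
  assumes "A \<subseteq> {1..n}" "\<And>i. i \<in> {1..n} - A \<Longrightarrow> f i = 0"
  shows "(\<Sum>i=1..n. f i) = (\<Sum>i\<in>A. f i)"
  using assms by (intro sum.mono_neutral_right) auto

locale special_coweight_lie = split_simple_lie +
  fixes \<theta> :: "'a \<Rightarrow> complex" and m :: "nat \<Rightarrow> nat" and \<tau> :: 'a
  assumes highest: "highest_root h n \<alpha> \<theta>" and theta_eq: "\<theta> = nat_comb n \<alpha> m"
    and special: "\<tau> \<in> special_coweights h n \<alpha> \<theta>"
begin

lemma special_tau_h: "\<tau> \<in> h"
  using special by (simp add: special_coweights_def coweight_lattice_def)

lemma special_alpha_nat: assumes i: "i \<in> {1..n}" shows "\<alpha> i \<tau> \<in> \<nat>"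
proof -
  have "\<alpha> i \<tau> \<in> \<int>" "Re (\<alpha> i \<tau>) \<ge> 0"
    using special alpha_root[OF i] i by (auto simp: special_coweights_def coweight_lattice_def)
  then obtain k :: int where "\<alpha> i \<tau> = of_int k" "k \<ge> 0" by (auto elim!: Ints_cases)
  then have "\<alpha> i \<tau> = of_nat (nat k)" by simp
  then show ?thesis by (simp only: of_nat_in_Nats)
qed

text \<open>The coordinates of \<open>\<tau>\<close> in the fundamental coweights, as natural
  numbers. The choice is meaningful for indices in \<open>{1..n}\<close>.\<close>

definition tau_coeff :: "nat \<Rightarrow> nat" where
  "tau_coeff i = (SOME k. \<alpha> i \<tau> = of_nat k)"

lemma alpha_tau_coeff: "i \<in> {1..n} \<Longrightarrow> \<alpha> i \<tau> = of_nat (tau_coeff i)"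
  unfolding tau_coeff_def by (rule someI_ex) (use special_alpha_nat in \<open>blast elim: Nats_cases\<close>)

lemma nat_comb_tau_coeff: "nat_comb n \<alpha> k \<tau> = of_nat (\<Sum>i=1..n. k i * tau_coeff i)"
  unfolding nat_comb_def of_nat_sum by (intro sum.cong) (auto simp: alpha_tau_coeff)

lemma highest_coefficients:
  assumes "\<And>x. nat_comb n \<alpha> k x = \<beta> x" "\<beta> \<in> roots h" "i \<in> {1..n}"
  shows "k i \<le> m i"
proof -
  obtain k' where k': "(\<lambda>x. \<theta> x - \<beta> x) = nat_comb n \<alpha> k'"
    using highest assms(2) by (auto simp: highest_root_def)
  have "of_nat (m i) = (of_nat (k i) + of_nat (k' i) :: complex)"
  proof (rule nat_comb_inj[OF _ assms(3)])
    fix x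
    have "\<theta> x = \<beta> x + nat_comb n \<alpha> k' x" using fun_cong[OF k', of x] by (simp add: algebra_simps)
    then show "(\<Sum>i=1..n. of_nat (m i) * \<alpha> i x) = (\<Sum>i=1..n. (of_nat (k i) + of_nat (k' i)) * \<alpha> i x)"
      by (simp add: theta_eq nat_comb_def distrib_right sum.distrib flip: assms(1))
  qed
  then have "of_nat (m i) = (of_nat (k i + k' i) :: complex)" by simp
  then have "m i = k i + k' i" by (simp only: of_nat_eq_iff)
  then show ?thesis by simp
qed

text \<open>The simple root at i is itself a root with coefficient 1, and coefficients of roots are
  bounded by those of \<open>\<theta>\<close>.\<close>

lemma m_pos: assumes i: "i \<in> {1..n}" shows "m i \<ge> 1"
proof -
  have "nat_comb n \<alpha> (\<lambda>j. if j = i then 1 else 0) x = \<alpha> i x" for x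
  proof -
    have "nat_comb n \<alpha> (\<lambda>j. if j = i then 1 else 0) x = (\<Sum>j=1..n. if j = i then \<alpha> j x else 0)"
      unfolding nat_comb_def by (intro sum.cong) auto
    also have "\<dots> = \<alpha> i x" using i by (simp del: One_nat_def)
    finally show ?thesis .
  qed
  from highest_coefficients[OF this alpha_root[OF i] i] show ?thesis by simp
qed

text \<open>The value of \<open>\<theta>\<close> at \<open>\<tau>\<close>, which bounds the degrees
  of all roots.\<close>

definition level :: nat where
  "level = (\<Sum>i=1..n. m i * tau_coeff i)"

lemma theta_tau: "\<theta> \<tau> = of_nat level"
  unfolding level_def theta_eq by (rule nat_comb_tau_coeff)

lemma level_le: "level \<le> 2"
proof -
  have "Re (\<theta> \<tau>) \<le> 2" using special by (simp add: special_coweights_def)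
  then have "real level \<le> 2" by (simp add: theta_tau)
  then show ?thesis by linarith
qed

lemma root_tau_level: assumes "\<beta> \<in> roots h" shows "Re (\<beta> \<tau>) \<le> level"
proof (rule root_cases[OF assms])
  fix k assume k: "\<beta> = nat_comb n \<alpha> k"
  have "k i \<le> m i" if "i \<in> {1..n}" for i
    using highest_coefficients[OF _ assms that] k by simp
  then have "(\<Sum>i=1..n. k i * tau_coeff i) \<le> level" unfolding level_def by (intro sum_mono mult_right_mono) auto
  then show ?thesis unfolding k nat_comb_tau_coeff complex_Re_of_nat by (rule of_nat_mono)
next
  fix k assume "\<beta> = (\<lambda>x. - nat_comb n \<alpha> k x)"
  then have "Re (\<beta> \<tau>) \<le> 0" by (simp add: nat_comb_tau_coeff del: of_nat_sum)
  then show ?thesis by (rule order_trans) simp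
qed

end

sublocale special_coweight_lie \<subseteq> graded_lie
proof
  show "Re (l \<tau>) \<le> 2" if "l \<in> roots h" for l
    using root_tau_level[OF that] level_le by linarith
qed (fact special_tau_h special_alpha_nat)+

context special_coweight_lie
begin

lemma theta_pos: "\<theta> \<in> pos_roots h n \<alpha>"
  using highest theta_eq by (auto simp: highest_root_def pos_roots_def)

lemma roots_at_level_2: "roots_at_level h n \<alpha> \<tau> 2 \<noteq> {} \<longleftrightarrow> level = 2"
proof
  assume "roots_at_level h n \<alpha> \<tau> 2 \<noteq> {}"
  then obtain \<beta> where "\<beta> \<in> roots h" "\<beta> \<tau> = 2" by (auto simp: roots_at_level_def pos_roots_def)
  then show "level = 2" using root_tau_level[of \<beta>] level_le by simp
next
  assume "level = 2"
  then have "\<theta> \<in> roots_at_level h n \<alpha> \<tau> 2" using theta_pos by (simp add: roots_at_level_def theta_tau)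
  then show "roots_at_level h n \<alpha> \<tau> 2 \<noteq> {}" by blast
qed

lemma grade_2_nonzero: "grade 2 \<noteq> {0} \<longleftrightarrow> level = 2"
proof
  assume "grade 2 \<noteq> {0}"
  then obtain \<beta> where "\<beta> \<in> pos_roots h n \<alpha>" "\<beta> \<tau> = of_int 2" by (rule grade_nonzero) auto
  then have "\<beta> \<in> roots_at_level h n \<alpha> \<tau> 2" by (simp add: roots_at_level_def)
  then show "level = 2" using roots_at_level_2 by blast
next
  assume "level = 2"
  then show "grade 2 \<noteq> {0}"
    using theta_pos by (intro root_grade_nonzero[of \<theta>]) (auto simp: pos_roots_def theta_tau)
qed

lemma tau_expansion: "\<tau> = (\<Sum>i=1..n. of_nat (tau_coeff i) *\<^sub>C \<omega> i)"
proof -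
  have "(\<Sum>i=1..n. of_nat (tau_coeff i) *\<^sub>C \<omega> i) = (\<Sum>i=1..n. \<alpha> i \<tau> *\<^sub>C \<omega> i)"
    by (intro sum.cong) (auto simp: alpha_tau_coeff)
  then show ?thesis using omega_expansion[OF special_tau_h] by simp
qed

lemma tau_coeff_eq:
  assumes "\<tau> = (\<Sum>i=1..n. of_nat (s i) *\<^sub>C \<omega> i)" "i \<in> {1..n}" shows "tau_coeff i = s i"
proof -
  have "(of_nat (tau_coeff i) :: complex) = of_nat (s i)"
    using alpha_tau_coeff[OF assms(2)] alpha_omega_comb[OF assms(2), of "\<lambda>i. of_nat (s i)"] assms(1) by simp
  then show ?thesis by simp
qed

lemma one_coweight:
  assumes "\<tau> = of_nat c *\<^sub>C \<omega> i" "i \<in> {1..n}"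
  shows "j \<in> {1..n} \<Longrightarrow> tau_coeff j = (if j = i then c else 0)" "level = m i * c"
proof -
  let ?s = "\<lambda>j. if j = i then c else 0"
  have "\<tau> = (\<Sum>j=1..n. of_nat (?s j) *\<^sub>C \<omega> j)"
    using assms by (subst sum_support[of "{i}"]) auto
  from tau_coeff_eq[OF this] show t: "tau_coeff j = ?s j" if "j \<in> {1..n}" for j using that .
  then show "level = m i * c" unfolding level_def using assms by (subst sum_support[of "{i}"]) auto
qed

lemma two_coweights:
  assumes "\<tau> = \<omega> i + \<omega> j" "i \<in> {1..n}" "j \<in> {1..n}" "i \<noteq> j"
  shows "k \<in> {1..n} \<Longrightarrow> tau_coeff k = (if k = i \<or> k = j then 1 else 0)" "level = m i + m j"
proof -
  let ?s = "\<lambda>k. if k = i \<or> k = j then 1 else 0 :: nat"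
  have "\<tau> = (\<Sum>k=1..n. of_nat (?s k) *\<^sub>C \<omega> k)"
    using assms by (subst sum_support[of "{i, j}"]) auto
  from tau_coeff_eq[OF this] show t: "tau_coeff k = ?s k" if "k \<in> {1..n}" for k using that .
  then show "level = m i + m j" unfolding level_def using assms by (subst sum_support[of "{i, j}"]) auto
qed

text \<open>Each index with a positive coordinate contributes at least 1 to a total of at most 2. So
  there are at most two such indices, and two of them use up the whole total.\<close>

lemma special_cases:
  obtains (double) i where "i \<in> {1..n}" "m i = 1" "\<tau> = 2 *\<^sub>C \<omega> i"
    | (mark2) i where "i \<in> {1..n}" "m i = 2" "\<tau> = \<omega> i"
    | (pair) i j where "i \<in> {1..n}" "j \<in> {1..n}" "m i = 1" "m j = 1" "i \<noteq> j" "\<tau> = \<omega> i + \<omega> j"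
    | (mark1) i where "i \<in> {1..n}" "m i = 1" "\<tau> = \<omega> i"
    | (zero) "\<tau> = 0"
proof (cases "\<exists>i\<in>{1..n}. tau_coeff i > 0")
  case False
  then have "\<tau> = 0" by (intro trans[OF tau_expansion] sum.neutral) auto
  then show ?thesis by (rule zero)
next
  case True
  then obtain i where i: "i \<in> {1..n}" "tau_coeff i > 0" by blast
  have part: "(\<Sum>j\<in>A. m j * tau_coeff j) \<le> 2" if "A \<subseteq> {1..n}" for A
    using level_le that sum_mono2[of "{1..n}" A "\<lambda>j. m j * tau_coeff j"] unfolding level_def by simp
  have ge: "tau_coeff j \<le> m j * tau_coeff j" if "j \<in> {1..n}" for j using m_pos[OF that] by simp
  show ?thesis
  proof (cases "\<exists>j\<in>{1..n}. j \<noteq> i \<and> tau_coeff j > 0")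
    case False
    then have tau: "\<tau> = of_nat (tau_coeff i) *\<^sub>C \<omega> i"
      using i by (intro trans[OF tau_expansion], subst sum_support[of "{i}"]) auto
    have le: "m i * tau_coeff i \<le> 2" using part[of "{i}"] i by simp
    then have "tau_coeff i \<le> 2" using ge[OF i(1)] by linarith
    then consider "tau_coeff i = 1" | "tau_coeff i = 2" using i(2) by linarith
    then show ?thesis
    proof cases
      case 1
      then consider "m i = 1" | "m i = 2" using le m_pos[OF i(1)] by fastforce
      then show ?thesis using mark1[of i] mark2[of i] i(1) tau 1 by cases auto
    next
      case 2
      then have "m i = 1" using le m_pos[OF i(1)] by simp
      then show ?thesis using double[of i] i(1) tau 2 by simp
    qed
  next
    case True
    then obtain j where j: "j \<in> {1..n}" "j \<noteq> i" "tau_coeff j > 0" by blast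
    have le: "m i * tau_coeff i + m j * tau_coeff j \<le> 2" using part[of "{i, j}"] i j by simp
    have pos: "m i * tau_coeff i \<ge> 1" "m j * tau_coeff j \<ge> 1" using ge i j by (auto simp: Suc_le_eq dest!: m_pos)
    then have one: "m i * tau_coeff i = 1" "m j * tau_coeff j = 1" using le by linarith+
    have "tau_coeff k = 0" if "k \<in> {1..n} - {i, j}" for k
    proof -
      have "m k * tau_coeff k + (m i * tau_coeff i + m j * tau_coeff j) \<le> 2" using part[of "{k, i, j}"] that i j by auto
      then have "m k * tau_coeff k = 0" using one by simp
      then show ?thesis using m_pos[of k] that by simp
    qed
    then have "\<tau> = \<omega> i + \<omega> j"
      using i j one by (intro trans[OF tau_expansion], subst sum_support[of "{i, j}"]) (auto simp: complex_lie.scale_one)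
    then show ?thesis using pair[of i j] i j one by auto
  qed
qed

text \<open>Parity: every root takes an even value at \<open>\<tau>\<close>.\<close>

lemma double_grade_1:
  assumes i: "i \<in> {1..n}" "\<tau> = 2 *\<^sub>C \<omega> i" shows "grade 1 = {0}"
proof (rule ccontr)
  assume "grade 1 \<noteq> {0}"
  then obtain \<beta> where b: "\<beta> \<in> pos_roots h n \<alpha>" "\<beta> \<tau> = of_int 1" by (rule grade_nonzero) auto
  then obtain k where "\<beta> = nat_comb n \<alpha> k" by (auto simp: pos_roots_def)
  then have "of_nat (\<Sum>j=1..n. k j * tau_coeff j) = (of_nat 1 :: complex)" using b(2) by (simp add: nat_comb_tau_coeff del: of_nat_sum)
  then have "(\<Sum>j=1..n. k j * tau_coeff j) = 1" by (simp only: of_nat_eq_iff)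
  moreover have "even (\<Sum>j=1..n. k j * tau_coeff j)"
    using one_coweight(1)[of 2 i] i by (intro dvd_sum) auto
  ultimately show False by simp
qed

text \<open>The common core of cases (2) and (3): coordinates 0 and 1 give generation in degree 1,
  and the simple root at i makes degree 1 nonzero, whence the strict inclusion.\<close>

lemma nilradical_complement:
  assumes i: "i \<in> {1..n}" "tau_coeff i = 1" and t1: "\<And>j. j \<in> {1..n} \<Longrightarrow> tau_coeff j \<le> 1" and lev: "level = 2"
  shows "\<not> nilradical_abelian_ideal (grade 2) b" "grade 2 \<subset> filtration 1"
    "grade 2 = commutator (filtration 1) (filtration 1)"
proof -
  have "tau_coeff j = 0 \<or> tau_coeff j = 1" if "j \<in> {1..n}" for j using t1[OF that] by linarith
  then have gen: "grade 2 = commutator (grade 1) (grade 1)"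
    by (intro grade_2_generated) (metis alpha_tau_coeff of_nat_0 of_nat_1)
  show "\<not> nilradical_abelian_ideal (grade 2) b"
    using gen lev grade_2_nonzero by (intro not_nilradical) auto
  have "grade 2 \<subseteq> commutator (filtration 1) (filtration 1)"
    unfolding gen by (intro commutator_mono grade_filtration) auto
  moreover have "commutator (filtration 1) (filtration 1) \<subseteq> grade 2"
    using filtration_bracket[of _ 1 _ 1] by (intro commutator_subset csubspace_grade) (simp add: filtration_2)
  ultimately show "grade 2 = commutator (filtration 1) (filtration 1)" by blast
  have "grade 1 \<noteq> {0}"
    using i alpha_tau_coeff[OF i(1)] by (intro root_grade_nonzero[OF alpha_root[OF i(1)]]) simp
  then obtain x where x: "x \<in> grade 1" "x \<noteq> 0" using csubspaceD(1)[OF csubspace_grade] by blast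
  then have "x \<in> filtration 1" "x \<notin> grade 2" using grade_filtration[of 1 1] grade_disjoint[of x 1 2] by auto
  then show "grade 2 \<subset> filtration 1" using grade_filtration[of 1 2] by auto
qed

end

theorem proposition3p5:
  fixes h b :: "'a::complex_lie_algebra set"
    and n :: nat
    and \<alpha> :: "nat \<Rightarrow> 'a \<Rightarrow> complex"
    and \<theta> :: "'a \<Rightarrow> complex"
    and m :: "nat \<Rightarrow> nat"
    and \<omega> :: "nat \<Rightarrow> 'a"
    and \<tau> :: 'a
  defines "J \<equiv> {i \<in> {1..n}. m i = 1}"
  defines "case1 \<equiv> \<exists>i\<in>J. \<tau> = 2 *\<^sub>C \<omega> i"
    and "case2 \<equiv> \<exists>i\<in>{1..n}. m i = 2 \<and> \<tau> = \<omega> i"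
    and "case3 \<equiv> \<exists>i\<in>J. \<exists>j\<in>J. i \<noteq> j \<and> \<tau> = \<omega> i + \<omega> j"
    and "case4 \<equiv> \<exists>i\<in>J. \<tau> = \<omega> i"
    and "case5 \<equiv> \<tau> = 0"
  assumes "finite_dimensional_lie TYPE('a)"
    and "simple_lie (UNIV :: 'a set)"
    and "cartan_subalgebra h"
    and "simple_system h n \<alpha>"
    and "borel_subalgebra b"
    and "internal_direct_sum b h (root_space_sum h (pos_roots h n \<alpha>))"
    and "highest_root h n \<alpha> \<theta>"
    and "\<theta> = nat_comb n \<alpha> m"
    and "fundamental_coweights h n \<alpha> \<omega>"
    and "\<tau> \<in> special_coweights h n \<alpha> \<theta>"
  shows "(case1 \<or> case2 \<or> case3 \<or> case4 \<or> case5) \<and>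
    (roots_at_level h n \<alpha> \<tau> 2 \<noteq> {} \<longleftrightarrow> case1 \<or> case2 \<or> case3) \<and>
    (special_ideal h n \<alpha> \<tau> \<noteq> {0} \<longleftrightarrow> case1 \<or> case2 \<or> case3) \<and>
    abelian_ideal (special_ideal h n \<alpha> \<tau>) b \<and>
    (case1 \<longrightarrow> nilradical_abelian_ideal (special_ideal h n \<alpha> \<tau>) b) \<and>
    (special_ideal h n \<alpha> \<tau> \<noteq> {0} \<and> nilradical_abelian_ideal (special_ideal h n \<alpha> \<tau>) b \<longrightarrow> case1) \<and>
    (case2 \<or> case3 \<longrightarrow>
       \<not> nilradical_abelian_ideal (special_ideal h n \<alpha> \<tau>) b \<and>
       special_ideal h n \<alpha> \<tau> \<subset> n_sub h n \<alpha> \<tau> \<and>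
       special_ideal h n \<alpha> \<tau> = commutator (n_sub h n \<alpha> \<tau>) (n_sub h n \<alpha> \<tau>))"
proof -
  have tor: "toral_subalgebra h" using assms(9) by (simp add: cartan_subalgebra_def)
  obtain B w where B: "finite B" "complex_lie.independent B" "cspan B = (UNIV :: 'a set)"
    "\<And>b. b \<in> B \<Longrightarrow> w b \<in> dual_of h" "\<And>b. b \<in> B \<Longrightarrow> b \<in> root_space h (w b)"
    using weight_basis_exists[OF assms(7) tor] by blast
  \<comment> \<open>\<open>self_centralizing\<close> is the one locale assumption that draws on the
    Borel subalgebra.\<close>
  interpret special_coweight_lie h n \<alpha> \<omega> B w \<theta> m \<tau>
  proof
    show "x \<in> h" if "\<And>H. H \<in> h \<Longrightarrow> bracket H x = 0" for x
      using borel_imp_self_centralizing[OF tor assms(11,12) _ that] by (auto simp: pos_roots_def)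
  qed (use assms B tor in \<open>auto simp: toral_subalgebra_def lie_subalgebra_def abelian_lie_def\<close>)
  have beq: "b = {x + y | x y. x \<in> h \<and> y \<in> root_space_sum h (pos_roots h n \<alpha>)}"
    using assms(12) by (simp add: internal_direct_sum_def)
  have b0: "b \<subseteq> filtration 0"
    unfolding beq using h_grade_0 grade_filtration[of 0 0] pos_sum_filtration_0
    by (auto intro!: csubspaceD(2)[OF csubspace_filtration])
  have "special_ideal h n \<alpha> \<tau> \<subseteq> root_space_sum h (pos_roots h n \<alpha>)"
    unfolding special_ideal_def root_space_sum_def roots_at_level_def
    by (intro complex_lie.span_mono) auto
  also have "\<dots> \<subseteq> b" unfolding beq by (rule subset_sums(2)[OF h_subspace])
  finally have "grade 2 \<subseteq> b" by (simp add: special_ideal_eq)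
  then have ab: "abelian_ideal (grade 2) b"
    using abelian_grade_2 filtration_0_normalizes b0
    by (auto simp: abelian_ideal_def lie_ideal_def csubspace_grade)
  have all: "case1 \<or> case2 \<or> case3 \<or> case4 \<or> case5"
    by (rule special_cases) (auto simp: assms(1-6))
  have l1: "level = 2" if case1
    using that one_coweight(2)[of 2] by (auto simp: case1_def J_def)
  have l2: "level = 2" if case2
    using that one_coweight(2)[of 1] by (auto simp: case2_def complex_lie.scale_one)
  have l3: "level = 2" if case3
    using that two_coweights(2) by (auto simp: case3_def J_def)
  have l4: "level \<noteq> 2" if case4
    using that one_coweight(2)[of 1] by (auto simp: case4_def J_def)
  have l5: "level \<noteq> 2" if case5
  proof -
    have "\<theta> \<tau> = 0"
      using that dual_linear(3)[of \<theta>] theta_pos by (simp add: case5_def pos_roots_def roots_def)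
    then show ?thesis by (simp add: theta_tau)
  qed
  \<comment> \<open>The levels in the five cases are 2, 2, 2, 1 and 0.\<close>
  have lev: "level = 2 \<longleftrightarrow> case1 \<or> case2 \<or> case3" using all l1 l2 l3 l4 l5 by blast
  have c1: "nilradical_abelian_ideal (grade 2) b" if case1
    using that double_grade_1 assms(11) b0 ab by (intro nilradical_grade_2) (auto simp: case1_def J_def)
  have c23: "\<not> nilradical_abelian_ideal (grade 2) b \<and> grade 2 \<subset> filtration 1 \<and>
      grade 2 = commutator (filtration 1) (filtration 1)" if c: "case2 \<or> case3"
  proof -
    have "\<exists>i\<in>{1..n}. tau_coeff i = 1 \<and> (\<forall>j\<in>{1..n}. tau_coeff j \<le> 1)"
      using c
    proof
      assume case2
      then obtain i where i: "i \<in> {1..n}" "\<tau> = of_nat 1 *\<^sub>C \<omega> i" by (auto simp: case2_def)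
      from one_coweight(1)[OF i(2,1)] show ?thesis using i(1) by (intro bexI[of _ i]) auto
    next
      assume case3
      then obtain i j where i: "\<tau> = \<omega> i + \<omega> j" "i \<in> {1..n}" "j \<in> {1..n}" "i \<noteq> j"
        by (auto simp: case3_def J_def)
      from two_coweights(1)[OF i] show ?thesis using i(2) by (intro bexI[of _ i]) auto
    qed
    then obtain i where i: "i \<in> {1..n}" "tau_coeff i = 1" "\<And>j. j \<in> {1..n} \<Longrightarrow> tau_coeff j \<le> 1" by blast
    have "level = 2" using c lev by blast
    from nilradical_complement[OF i this] show ?thesis by blast
  qed
  \<comment> \<open>The converse in case (1) is by exhaustion: a nonzero ideal leaves cases (1) to
    (3), and \<open>c23\<close> excludes the other two.\<close>
  show ?thesis
    unfolding special_ideal_eq n_sub_eq roots_at_level_2 grade_2_nonzero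
    using all lev ab c1 c23 by blast
qed

end
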